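(* Let $\mathcal{X}^A$ and $\mathcal{X}^B$ be irreducible, time-homogeneous, continuous-time Markov chains on the finite state spaces $\mathcal{V}^A=\{-r+3,\dots,0,1,2\}$ ($r\ge 2$) and $\mathcal{V}^B=\{1,2,\dots,s\}$ ($s\ge 2$), with stationary distributions $\pi^A$ and $\pi^B$, and let $\pi$ be the stationary distribution of the chain $\mathcal{X}$ glued from them at the states $1$ and $2$. If $$\frac{\pi^A_1}{\pi^A_2}\neq\frac{\pi^B_1}{\pi^B_2},$$ then for $i\in\mathcal{S}^A$, $$v_i=\frac{\pi^A_2\pi_i-\pi_2\pi^A_i}{\pi^A_2\pi_1-\pi_2\pi^A_1},\qquad w_i=\frac{\pi^A_1\pi_i-\pi_1\pi^A_i}{\pi^A_1\pi_2-\pi_1\pi^A_2},$$ and for $j\in\mathcal{S}^B$, $$x_j=\frac{\pi^B_2\pi_j-\pi_2\pi^B_j}{\pi^B_2\pi_1-\pi_2\pi^B_1},\qquad y_j=\frac{\pi^B_1\pi_j-\pi_1\pi^B_j}{\pi^B_1\pi_2-\pi_1\pi^B_2}.$$ Additionally, for $i\in\mathcal{S}^A$ and $j\in\mathcal{S}^B$, $$\min\left\{\frac{\pi_1}{\pi^A_1},\frac{\pi_2}{\pi^A_2}\right\}\le\frac{\pi_i}{\pi^A_i}\le\max\left\{\frac{\pi_1}{\pi^A_1},\frac{\pi_2}{\pi^A_2}\right\},$$ $$\min\left\{\frac{\pi_1}{\pi^B_1},\frac{\pi_2}{\pi^B_2}\right\}\le\frac{\pi_j}{\pi^B_j}\le\max\left\{\frac{\pi_1}{\pi^B_1},\frac{\pi_2}{\pi^B_2}\right\},$$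 and $$\min\left\{\frac{\pi^A_1}{\pi^A_2},\frac{\pi^B_1}{\pi^B_2}\right\}<\frac{\pi_1}{\pi_2}<\max\left\{\frac{\pi^A_1}{\pi^A_2},\frac{\pi^B_1}{\pi^B_2}\right\}.$$
   Context: Setting. $Q^A$ and $Q^B$ are the transition rate matrices of $\mathcal{X}^A$ and $\mathcal{X}^B$: for $i\ne j$, $Q^\delta_{ij}\ge 0$ is the transition rate from $i$ to $j$, and $Q^\delta_{ii}=-\sum_{j\neq i}Q^\delta_{ij}$ ($\delta\in\{A,B\}$). Put $\mathcal{S}^A=\mathcal{V}^A\setminus\{1,2\}=\{-r+3,\dots,0\}$ and $\mathcal{S}^B=\mathcal{V}^B\setminus\{1,2\}=\{3,\dots,s\}$ (possibly empty). Glued chain. $\mathcal{X}$ is the continuous-time Markov chain on $\mathcal{S}^A\cup\{1,2\}\cup\mathcal{S}^B=\{-r+3,\dots,s\}$ with transition rate matrix $$Q_{ij}=Q^A_{ij}\,\mathbf 1(i,j\le 2)+Q^B_{ij}\,\mathbf 1(i,j\ge 1).$$ The stationary distributions $\pi^A,\pi^B,\pi$ are the probability vectors with $(\pi^A)^{\mathrm T}Q^A=0$, $(\pi^B)^{\mathrm T}Q^B=0$, $\pi^{\mathrm T}Q=0$; by irreducibility they exist uniquely and are strictly positive. Hitting times. For $\delta\in\{A,B\}$, $\varepsilon\in\{1,2\}$, $$\sigma^\delta_\varepsilon=\begin{cases}\inf\{t>0\,|\,\exists u\in(0,t):\ \mathcal{X}^\delta_u\ne\varepsilon,\ \mathcal{X}^\delta_t=\varepsilon\},&\text{if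 }\mathcal{X}^\delta_0=\varepsilon,\\ \inf\{t>0\,|\,\mathcal{X}^\delta_t=\varepsilon\},&\text{otherwise.}\end{cases}$$ Excursion probabilities and intensities. For $\delta\in\{A,B\}$ and $\varepsilon,\varepsilon'\in\{1,2\}$, $$p^\delta_{\varepsilon\delta\varepsilon'}=\mathrm P(\sigma^\delta_{\varepsilon'}<\sigma^\delta_{3-\varepsilon'}\,|\,\mathcal{X}^\delta_0=\varepsilon),\qquad q_{\varepsilon\delta}=-Q^\delta_{\varepsilon\varepsilon},\qquad q^\delta_{\varepsilon\delta\varepsilon'}=q_{\varepsilon\delta}\,p^\delta_{\varepsilon\delta\varepsilon'}.$$ Occupation times. For $k\in\mathcal{S}^\delta$, $\chi^\delta_{\varepsilon'}(k)=\int_0^{\sigma^\delta_{\varepsilon'}}\mathbf 1(\mathcal{X}^\delta_t=k)\,\mathrm dt$, and $$\mathrm E_{\varepsilon\varepsilon'}[\chi^\delta_{\varepsilon'}(k)]=\frac{\mathrm E_\varepsilon[\chi^\delta_{\varepsilon'}(k)\mathbf 1(\sigma^\delta_{\varepsilon'}<\sigma^\delta_{3-\varepsilon'})]}{\mathrm P_\varepsilon(\sigma^\delta_{\varepsilon'}<\sigma^\delta_{3-\varepsilon'})}$$ if the denominator is nonzero, and $0$ otherwise; here $\mathrm P_\varepsilon,\mathrm E_\varepsilon$ are probability and expectation for the process started from $\varepsilon$. Vectors. $v,w\in[0,\infty)^{r-2}$ (indexed by $\mathcal{S}^A$) and $x,y\in[0,\infty)^{s-2}$ (indexed by $\mathcal{S}^B$)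 are \begin{align*} v_i&=q^A_{1A1}\mathrm E_{11}[\chi^A_1(i)]+q^A_{1A2}\mathrm E_{12}[\chi^A_2(i)],\\ w_i&=q^A_{2A2}\mathrm E_{22}[\chi^A_2(i)]+q^A_{2A1}\mathrm E_{21}[\chi^A_1(i)]\qquad(i\in\mathcal{S}^A),\\ x_j&=q^B_{1B1}\mathrm E_{11}[\chi^B_1(j)]+q^B_{1B2}\mathrm E_{12}[\chi^B_2(j)],\\ y_j&=q^B_{2B2}\mathrm E_{22}[\chi^B_2(j)]+q^B_{2B1}\mathrm E_{21}[\chi^B_1(j)]\qquad(j\in\mathcal{S}^B). \end{align*} *)

theory Defs
  imports "HOL-Probability.Probability"
begin

definition rate_matrix :: "int set \<Rightarrow> (int \<Rightarrow> int \<Rightarrow> real) \<Rightarrow> bool" where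
  "rate_matrix V Q \<longleftrightarrow>
     (\<forall>i\<in>V. \<forall>j\<in>V. i \<noteq> j \<longrightarrow> 0 \<le> Q i j) \<and>
     (\<forall>i\<in>V. Q i i = - (\<Sum>j\<in>V - {i}. Q i j))"

definition stationary_distribution :: "int set \<Rightarrow> (int \<Rightarrow> int \<Rightarrow> real) \<Rightarrow> (int \<Rightarrow> real) \<Rightarrow> bool" where
  "stationary_distribution V Q p \<longleftrightarrow>
     (\<forall>i\<in>V. 0 \<le> p i) \<and> (\<Sum>i\<in>V. p i) = 1 \<and> (\<forall>j\<in>V. (\<Sum>i\<in>V. p i * Q i j) = 0)"

text \<open>
  A time-homogeneous continuous-time Markov chain on the finite state space \<open>V\<close>, given as a
  family of laws: under \<open>M i\<close> the process \<open>X\<close> starts from \<open>i\<close>. The transition function is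
  \<open>t \<mapsto> \<P>(\<omega> in M i. X t \<omega> = j)\<close>, and \<open>Q\<close> is its right derivative at \<open>0\<close>. Only times \<open>t \<ge> 0\<close>
  are constrained. In the Markov property \<open>J\<close> is a finite set of times before the present
  time \<open>s\<close>, at which the past states \<open>x u\<close> (\<open>u \<in> J\<close>) are prescribed.
\<close>

locale ctmc =
  fixes V :: "int set"
    and M :: "int \<Rightarrow> 'w measure"
    and X :: "real \<Rightarrow> 'w \<Rightarrow> int"
    and Q :: "int \<Rightarrow> int \<Rightarrow> real"
  assumes finite_states: "finite V"
    and rate_matrix: "rate_matrix V Q"
    and prob_spaces: "\<And>i. i \<in> V \<Longrightarrow> prob_space (M i)"
    and random_variables: "\<And>i t. i \<in> V \<Longrightarrow> 0 \<le> t \<Longrightarrow> X t \<in> M i \<rightarrow>\<^sub>M count_space UNIV"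
    and state_space: "\<And>i t \<omega>. i \<in> V \<Longrightarrow> 0 \<le> t \<Longrightarrow> \<omega> \<in> space (M i) \<Longrightarrow> X t \<omega> \<in> V"
    and right_continuous:
      "\<And>i t \<omega>. i \<in> V \<Longrightarrow> 0 \<le> t \<Longrightarrow> \<omega> \<in> space (M i) \<Longrightarrow> continuous (at_right t) (\<lambda>u. X u \<omega>)"
    and start: "\<And>i. i \<in> V \<Longrightarrow> AE \<omega> in M i. X 0 \<omega> = i"
    and markov: "\<And>i j k s t J x.
      i \<in> V \<Longrightarrow> j \<in> V \<Longrightarrow> k \<in> V \<Longrightarrow> 0 \<le> s \<Longrightarrow> 0 \<le> t \<Longrightarrow> finite J \<Longrightarrow> J \<subseteq> {0..s} \<Longrightarrow>
      \<P>(\<omega> in M i. X s \<omega> = j \<and> (\<forall>u\<in>J. X u \<omega> = x u)) \<noteq> 0 \<Longrightarrow>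
      \<P>(\<omega> in M i. X (s + t) \<omega> = k \<bar> X s \<omega> = j \<and> (\<forall>u\<in>J. X u \<omega> = x u)) =
      \<P>(\<omega> in M j. X t \<omega> = k)"
    and transition_rates: "\<And>i j. i \<in> V \<Longrightarrow> j \<in> V \<Longrightarrow>
      ((\<lambda>t. \<P>(\<omega> in M i. X t \<omega> = j)) has_real_derivative Q i j) (at_right 0)"

locale irreducible_ctmc = ctmc +
  assumes irreducible: "\<And>i j. i \<in> V \<Longrightarrow> j \<in> V \<Longrightarrow> \<exists>t\<ge>0. 0 < \<P>(\<omega> in M i. X t \<omega> = j)"

definition hitting_time :: "(real \<Rightarrow> 'w \<Rightarrow> int) \<Rightarrow> int \<Rightarrow> 'w \<Rightarrow> ereal" where
  "hitting_time X e \<omega> =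
     (if X 0 \<omega> = e
      then Inf (ereal ` {t. 0 < t \<and> (\<exists>u\<in>{0<..<t}. X u \<omega> \<noteq> e) \<and> X t \<omega> = e})
      else Inf (ereal ` {t. 0 < t \<and> X t \<omega> = e}))"

text \<open>
  Below, \<open>e\<close> and \<open>e'\<close> are always one of the states \<open>1, 2\<close>, so that \<open>3 - e'\<close> is the other one.
  Occupation times and their expectations live in \<open>ennreal\<close>: an occupation time is infinite
  on paths that never hit \<open>e'\<close> and spend infinite time in \<open>k\<close>.
\<close>

definition excursion_prob :: "(int \<Rightarrow> 'w measure) \<Rightarrow> (real \<Rightarrow> 'w \<Rightarrow> int) \<Rightarrow> int \<Rightarrow> int \<Rightarrow> real" where
  "excursion_prob M X e e' =
     \<P>(\<omega> in M e. hitting_time X e' \<omega> < hitting_time X (3 - e') \<omega>)"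

definition excursion_intensity ::
    "(int \<Rightarrow> 'w measure) \<Rightarrow> (real \<Rightarrow> 'w \<Rightarrow> int) \<Rightarrow> (int \<Rightarrow> int \<Rightarrow> real) \<Rightarrow> int \<Rightarrow> int \<Rightarrow> real" where
  "excursion_intensity M X Q e e' = - Q e e * excursion_prob M X e e'"

definition occupation_time :: "(real \<Rightarrow> 'w \<Rightarrow> int) \<Rightarrow> int \<Rightarrow> int \<Rightarrow> 'w \<Rightarrow> ennreal" where
  "occupation_time X e' k \<omega> =
     (\<integral>\<^sup>+t. indicator {t. 0 \<le> t \<and> ereal t < hitting_time X e' \<omega> \<and> X t \<omega> = k} t \<partial>lborel)"

definition expected_occupation ::
    "(int \<Rightarrow> 'w measure) \<Rightarrow> (real \<Rightarrow> 'w \<Rightarrow> int) \<Rightarrow> int \<Rightarrow> int \<Rightarrow> int \<Rightarrow> ennreal" where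
  "expected_occupation M X e e' k =
     (if excursion_prob M X e e' \<noteq> 0
      then (\<integral>\<^sup>+\<omega>. occupation_time X e' k \<omega> *
              indicator {\<omega>. hitting_time X e' \<omega> < hitting_time X (3 - e') \<omega>} \<omega> \<partial>M e)
           / ennreal (excursion_prob M X e e')
      else 0)"

text \<open>With \<open>e = 1\<close> this is the vector \<open>v\<close> (or \<open>x\<close>), with \<open>e = 2\<close> the vector \<open>w\<close> (or \<open>y\<close>).\<close>

definition excursion_occupation ::
    "(int \<Rightarrow> 'w measure) \<Rightarrow> (real \<Rightarrow> 'w \<Rightarrow> int) \<Rightarrow> (int \<Rightarrow> int \<Rightarrow> real) \<Rightarrow> int \<Rightarrow> int \<Rightarrow> ennreal" where
  "excursion_occupation M X Q e k =
     ennreal (excursion_intensity M X Q e e) * expected_occupation M X e e k +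
     ennreal (excursion_intensity M X Q e (3 - e)) * expected_occupation M X e (3 - e) k"

definition states_A :: "nat \<Rightarrow> int set" where
  "states_A r = {- int r + 3..2}"

definition states_B :: "nat \<Rightarrow> int set" where
  "states_B s = {1..int s}"

definition glued_rates ::
    "(int \<Rightarrow> int \<Rightarrow> real) \<Rightarrow> (int \<Rightarrow> int \<Rightarrow> real) \<Rightarrow> int \<Rightarrow> int \<Rightarrow> real" where
  "glued_rates QA QB i j =
     QA i j * of_bool (i \<le> 2 \<and> j \<le> 2) + QB i j * of_bool (1 \<le> i \<and> 1 \<le> j)"

end

theory Submission
  imports Defs
begin

text \<open>
Everything rests on one description of the vectors \<open>v, w\<close> (and \<open>x, y\<close>). Let \<open>e\<close> be one of
the ports \<open>1, 2\<close> and \<open>u e k\<close> the occupation of an inner state \<open>k\<close> during an excursion from \<open>e\<close>,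
weighted with the rate \<open>- Q e e\<close> of leaving \<open>e\<close>. Then \<open>u e\<close> solves
\<open>Q e j + (\<Sum>k. u e k * Q k j) = 0\<close> for all inner states \<open>j\<close>: what enters \<open>j\<close> during an
excursion also leaves it.

Given this, the theorem is linear algebra. By irreducibility the matrix \<open>Q\<close> restricted to the
inner states is injective (\<open>killed_rates_injective\<close>). Both the stationary vector of a component
and the restriction to this component of the stationary vector \<open>p\<close> of the glued chain satisfy
the balance equations at its inner states; any such \<open>f\<close> is therefore determined by its values
at the ports, \<open>f k = f 1 * u 1 k + f 2 * u 2 k\<close> (\<open>interior_from_ports\<close>). Writing this for both
vectors and solving for \<open>u 1 k\<close> and \<open>u 2 k\<close> gives the formulas of the theorem, and the bounds
on the ratios hold because a mediant lies between the fractions that it combines. The same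
representation shows that the net flow of \<open>p\<close> into port \<open>1\<close> within one component is a positive
multiple of \<open>\<pi> 1 / \<pi> 2 - p 1 / p 2\<close>, where \<open>\<pi>\<close> is the stationary vector of the component
(\<open>net_flow_ratio\<close>). In the glued chain the flows within the two components cancel, so
\<open>p 1 / p 2\<close> lies strictly between the two ratios; in particular the denominators of the
formulas do not vanish.

The equation for \<open>u e\<close> is obtained without embedded jump chains or a strong Markov property.
Observe the chain only at multiples of a step \<open>h\<close>. Whether a sampled path is still in its first
excursion from \<open>e\<close> can be updated from the current state alone, so the simple Markov property
yields a linear recursion for the probability of being in state \<open>k\<close> at the \<open>n\<close>-th sample during
the excursion (\<open>alive_recursion\<close>). Summing the recursion over \<open>n\<close> gives a linear system whose
coefficients are the difference quotients of the transition function at \<open>h\<close>. As \<open>h\<close> tends to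
\<open>0\<close> these tend to \<open>Q\<close>, while \<open>h\<close> times the sums tends to the area of the region
\<open>{(\<omega>, t). the excursion of \<omega> is alive at time t and in state k}\<close>; here right-continuity gives
pointwise convergence and a geometric tail bound, uniform in \<open>h\<close>, gives domination
(\<open>sampled_excursion\<close>, \<open>excursion_mass_balance\<close>). By Tonelli the area is the expected occupation
time (\<open>excursion_occupation_eq_mass\<close>).
\<close>

section \<open>Balance equations of irreducible rate matrices\<close>

text \<open>
Irreducibility expressed by the rates: no proper nonempty set of states is closed. In this form
it is applied to the support of a vector, so no paths of positive rates have to be constructed.
\<close>

definition rates_irreducible :: "int set \<Rightarrow> (int \<Rightarrow> int \<Rightarrow> real) \<Rightarrow> bool" where
  "rates_irreducible V Q \<longleftrightarrow>
     (\<forall>C\<subseteq>V. C \<noteq> {} \<longrightarrow> (\<forall>i\<in>C. \<forall>j\<in>V - C. Q i j = 0) \<longrightarrow> C = V)"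

text \<open>
In the balance equation at a state \<open>j\<close> without mass all terms are nonnegative, so each of them
vanishes. This is why the support of a nonnegative balanced vector is a closed set of states.
\<close>

lemma balanced_column_vanishes:
  fixes d :: "int \<Rightarrow> real"
  assumes "finite S" "\<And>i. i \<in> S \<Longrightarrow> i \<noteq> j \<Longrightarrow> 0 \<le> Q i j" "\<And>i. i \<in> S \<Longrightarrow> 0 \<le> d i" "d j = 0"
    and "(\<Sum>i\<in>S. d i * Q i j) = 0" "i \<in> S"
  shows "d i * Q i j = 0"
proof -
  have nonneg: "0 \<le> d i * Q i j" if "i \<in> S" for i
    using assms(2)[OF that] assms(3)[OF that] assms(4) by (cases "i = j") auto
  then show ?thesis
    using sum_nonneg_eq_0_iff[OF assms(1) nonneg] assms(5,6) by auto
qed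

lemma stationary_positive:
  assumes "finite V" "\<And>i j. i \<in> V \<Longrightarrow> j \<in> V \<Longrightarrow> i \<noteq> j \<Longrightarrow> 0 \<le> Q i j" "rates_irreducible V Q"
    and "stationary_distribution V Q p" "i \<in> V"
  shows "0 < p i"
proof -
  note st = assms(4)[unfolded stationary_distribution_def]
  define C where "C = {i\<in>V. p i \<noteq> 0}"
  have "Q i j = 0" if "i \<in> C" "j \<in> V - C" for i j
    using balanced_column_vanishes[of V j Q p i] assms(1,2) st that by (auto simp: C_def)
  moreover have "C \<noteq> {}"
  proof
    assume "C = {}"
    then have "(\<Sum>i\<in>V. p i) = 0" by (intro sum.neutral) (auto simp: C_def)
    with st show False by simp
  qed
  ultimately have "C = V"
    using assms(3) unfolding rates_irreducible_def by (metis (no_types, lifting) C_def mem_Collect_eq subsetI)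
  with \<open>i \<in> V\<close> st show ?thesis by (force simp: C_def less_le)
qed

text \<open>
Leaving a proper subset \<open>S\<close> means being killed, and by irreducibility no balanced vector
survives. The diagonal rates are nonpositive, so \<open>\<bar>d\<bar>\<close> has nonnegative inflow at every state of
\<open>S\<close>; summing over \<open>S\<close> gives the negative of the outflow from \<open>S\<close>. Hence all these inflows and
the outflow vanish, which makes the support of \<open>d\<close> closed.
\<close>

lemma killed_rates_injective:
  fixes d :: "int \<Rightarrow> real"
  assumes "finite V" "rate_matrix V Q" "rates_irreducible V Q" "S \<subset> V"
    and balance: "\<And>j. j \<in> S \<Longrightarrow> (\<Sum>i\<in>S. d i * Q i j) = 0"
    and "i \<in> S"
  shows "d i = 0"
proof -
  have "finite S" using assms(1,4) finite_subset by blast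
  have Q: "0 \<le> Q i j" if "i \<in> V" "j \<in> V" "i \<noteq> j" for i j
    using assms(2) that by (auto simp: rate_matrix_def)
  have row: "(\<Sum>j\<in>S. Q i j) = - (\<Sum>j\<in>V - S. Q i j)" if "i \<in> S" for i
  proof -
    have "(\<Sum>j\<in>V. Q i j) = Q i i + (\<Sum>j\<in>V - {i}. Q i j)"
      using assms that by (subst sum.remove[of _ i]) auto
    also have "\<dots> = 0" using assms that by (auto simp: rate_matrix_def)
    finally show ?thesis
      using sum.subset_diff[of S V "Q i"] assms by auto
  qed
  have leave: "0 \<le> (\<Sum>j\<in>V - S. Q i j)" if "i \<in> S" for i
    using assms that by (intro sum_nonneg Q) auto
  have column: "0 \<le> (\<Sum>i\<in>S. \<bar>d i\<bar> * Q i j)" if "j \<in> S" for j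
  proof -
    have "Q j j = - (\<Sum>k\<in>V - {j}. Q j k)" using assms that by (auto simp: rate_matrix_def)
    also have "\<dots> \<le> 0" using assms that by (auto intro!: sum_nonneg Q)
    finally have diag: "Q j j \<le> 0" .
    have "d j * Q j j = - (\<Sum>i\<in>S - {j}. d i * Q i j)"
      using balance[OF that] \<open>finite S\<close> that by (simp add: sum.remove[of S j])
    then have "\<bar>d j\<bar> * - Q j j = \<bar>\<Sum>i\<in>S - {j}. d i * Q i j\<bar>"
      using diag by (metis abs_minus_cancel abs_mult abs_of_nonpos)
    also have "\<dots> \<le> (\<Sum>i\<in>S - {j}. \<bar>d i * Q i j\<bar>)" by (rule sum_abs)
    also have "\<dots> = (\<Sum>i\<in>S - {j}. \<bar>d i\<bar> * Q i j)"
      using assms that Q by (intro sum.cong) (auto simp: abs_mult subset_eq psubset_eq)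
    finally show ?thesis
      using \<open>finite S\<close> that by (simp add: sum.remove[of S j])
  qed
  have "(\<Sum>j\<in>S. \<Sum>i\<in>S. \<bar>d i\<bar> * Q i j) = (\<Sum>i\<in>S. \<bar>d i\<bar> * (\<Sum>j\<in>S. Q i j))"
    by (subst sum.swap) (simp add: sum_distrib_left)
  also have "\<dots> = - (\<Sum>i\<in>S. \<bar>d i\<bar> * (\<Sum>j\<in>V - S. Q i j))"
    by (simp add: row sum_negf)
  finally have total: "(\<Sum>j\<in>S. \<Sum>i\<in>S. \<bar>d i\<bar> * Q i j) = - (\<Sum>i\<in>S. \<bar>d i\<bar> * (\<Sum>j\<in>V - S. Q i j))" .
  have "0 \<le> (\<Sum>j\<in>S. \<Sum>i\<in>S. \<bar>d i\<bar> * Q i j)" using column by (rule sum_nonneg)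
  moreover have "0 \<le> (\<Sum>i\<in>S. \<bar>d i\<bar> * (\<Sum>j\<in>V - S. Q i j))" using leave by (intro sum_nonneg) auto
  ultimately have "(\<Sum>j\<in>S. \<Sum>i\<in>S. \<bar>d i\<bar> * Q i j) = 0"
    "(\<Sum>i\<in>S. \<bar>d i\<bar> * (\<Sum>j\<in>V - S. Q i j)) = 0" using total by auto
  then have inner: "\<And>j. j \<in> S \<Longrightarrow> (\<Sum>i\<in>S. \<bar>d i\<bar> * Q i j) = 0"
    and outer: "\<And>i. i \<in> S \<Longrightarrow> \<bar>d i\<bar> * (\<Sum>j\<in>V - S. Q i j) = 0"
    using column leave \<open>finite S\<close> by (auto simp: sum_nonneg_eq_0_iff)
  define C where "C = {i\<in>S. d i \<noteq> 0}"
  have "Q i j = 0" if "i \<in> C" "j \<in> V - C" for i j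
  proof (cases "j \<in> S")
    case True
    then show ?thesis
      using balanced_column_vanishes[of S j Q "\<lambda>i. \<bar>d i\<bar>" i] \<open>finite S\<close> Q assms(4) inner that
      by (auto simp: C_def)
  next
    case False
    have "(\<Sum>j\<in>V - S. Q i j) = 0" using outer[of i] that by (auto simp: C_def)
    moreover have "\<And>k. k \<in> V - S \<Longrightarrow> 0 \<le> Q i k" using that Q assms(4) by (auto simp: C_def)
    ultimately show ?thesis
      using False that assms(1) sum_nonneg_eq_0_iff[of "V - S" "Q i"] by auto
  qed
  moreover have "C \<subseteq> V" "C \<noteq> V" using assms(4) by (auto simp: C_def)
  ultimately have "C = {}" using assms(3) unfolding rates_irreducible_def by metis
  with \<open>i \<in> S\<close> show ?thesis by (auto simp: C_def)
qed

text \<open>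
The fraction in the middle is the average of \<open>a / c\<close> and \<open>b / d\<close> with weights proportional to
\<open>c * x\<close> and \<open>d * y\<close>.
\<close>

lemma mediant_bounds:
  fixes a b c d x y :: real
  assumes "0 < c" "0 < d" "0 \<le> x" "0 \<le> y" "0 < c * x + d * y"
  shows "min (a / c) (b / d) \<le> (a * x + b * y) / (c * x + d * y)"
    and "(a * x + b * y) / (c * x + d * y) \<le> max (a / c) (b / d)"
proof -
  have "min (a / c) (b / d) * c \<le> a" "min (a / c) (b / d) * d \<le> b"
    "a \<le> max (a / c) (b / d) * c" "b \<le> max (a / c) (b / d) * d"
    using assms by (auto simp: pos_le_divide_eq[symmetric] pos_divide_le_eq[symmetric])
  then have "min (a / c) (b / d) * c * x + min (a / c) (b / d) * d * y \<le> a * x + b * y"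
    "a * x + b * y \<le> max (a / c) (b / d) * c * x + max (a / c) (b / d) * d * y"
    using assms by (auto intro!: add_mono mult_right_mono)
  then show "min (a / c) (b / d) \<le> (a * x + b * y) / (c * x + d * y)"
    "(a * x + b * y) / (c * x + d * y) \<le> max (a / c) (b / d)"
    using assms by (auto simp: pos_le_divide_eq pos_divide_le_eq algebra_simps)
qed

text \<open>
A chain with the ports \<open>1\<close> and \<open>2\<close>, together with nonnegative solutions \<open>u 1\<close> and \<open>u 2\<close> of the
balance equations for excursions from these ports. The locale separates the linear algebra from
the probabilistic construction of \<open>u\<close>.
\<close>

locale excursion_system =
  fixes V :: "int set" and Q :: "int \<Rightarrow> int \<Rightarrow> real" and u :: "int \<Rightarrow> int \<Rightarrow> real"
  assumes finite_V: "finite V"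
    and ports: "1 \<in> V" "2 \<in> V"
    and rates: "rate_matrix V Q"
    and irred: "rates_irreducible V Q"
    and occupation_nonneg: "\<And>e i. e \<in> {1, 2} \<Longrightarrow> i \<in> V - {1, 2} \<Longrightarrow> 0 \<le> u e i"
    and occupation_balance: "\<And>e j. e \<in> {1, 2} \<Longrightarrow> j \<in> V - {1, 2} \<Longrightarrow>
      Q e j + (\<Sum>i\<in>V - {1, 2}. u e i * Q i j) = 0"
begin

lemma sum_split_ports:
  "(\<Sum>i\<in>V. f i) = f 1 + f 2 + (\<Sum>i\<in>V - {1, 2}. f i)" for f :: "int \<Rightarrow> real"
proof -
  have "(\<Sum>i\<in>V. f i) = (\<Sum>i\<in>V - {1, 2}. f i) + (\<Sum>i\<in>{1, 2}. f i)"
    using finite_V ports by (intro sum.subset_diff) auto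
  then show ?thesis by simp
qed

text \<open>
The combination on the right satisfies the same balance equations at the inner states as \<open>f\<close>
when it is extended by \<open>f 1\<close> and \<open>f 2\<close> at the ports, so the difference is annihilated by the
killed rates.
\<close>

lemma interior_from_ports:
  assumes "\<And>j. j \<in> V - {1, 2} \<Longrightarrow> (\<Sum>i\<in>V. f i * Q i j) = 0" "i \<in> V - {1, 2}"
  shows "f i = f 1 * u 1 i + f 2 * u 2 i"
proof -
  define d where "d i = f i - (f 1 * u 1 i + f 2 * u 2 i)" for i
  have "(\<Sum>i\<in>V - {1, 2}. d i * Q i j) = 0" if j: "j \<in> V - {1, 2}" for j
  proof -
    have "(\<Sum>i\<in>V - {1, 2}. d i * Q i j) = (\<Sum>i\<in>V - {1, 2}. f i * Q i j)
        - f 1 * (\<Sum>i\<in>V - {1, 2}. u 1 i * Q i j) - f 2 * (\<Sum>i\<in>V - {1, 2}. u 2 i * Q i j)"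
      by (simp add: d_def algebra_simps sum.distrib sum_subtractf sum_distrib_left)
    moreover have "(\<Sum>i\<in>V - {1, 2}. f i * Q i j) = - f 1 * Q 1 j - f 2 * Q 2 j"
      using assms(1)[OF j] sum_split_ports[of "\<lambda>i. f i * Q i j"] by simp
    moreover have "(\<Sum>i\<in>V - {1, 2}. u 1 i * Q i j) = - Q 1 j" "(\<Sum>i\<in>V - {1, 2}. u 2 i * Q i j) = - Q 2 j"
      using occupation_balance[of 1 j] occupation_balance[of 2 j] j by (simp_all add: eq_neg_iff_add_eq_0 add.commute)
    ultimately show ?thesis by simp
  qed
  moreover have "V - {1, 2} \<subset> V" using ports by blast
  ultimately have "d i = 0"
    using killed_rates_injective[OF finite_V rates irred _ _ assms(2)] by blast
  then show ?thesis by (simp add: d_def)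
qed

text \<open>
The rate of passing from port \<open>2\<close> to port \<open>1\<close>, either directly or through inner states: the
corresponding entry of the Schur complement of \<open>Q\<close> with respect to the inner states.
\<close>

definition passage_rate :: real where
  "passage_rate = Q 2 1 + (\<Sum>i\<in>V - {1, 2}. u 2 i * Q i 1)"

text \<open>
Otherwise port \<open>2\<close> and the inner states visited in excursions from it would form a closed set
that does not contain port \<open>1\<close>.
\<close>

lemma passage_rate_pos: "0 < passage_rate"
proof (rule ccontr)
  assume not_pos: "\<not> ?thesis"
  have Q: "0 \<le> Q i j" if "i \<in> V" "j \<in> V" "i \<noteq> j" for i j
    using rates that by (auto simp: rate_matrix_def)
  \<comment> \<open>\<open>d\<close> extends \<open>u 2\<close> by unit mass at port \<open>2\<close>, and its support \<open>C\<close> is shown to be closed.\<close>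
  define d where "d i = (if i = 1 then 0 else if i = 2 then 1 else u 2 i)" for i
  define C where "C = {i\<in>V. d i \<noteq> 0}"
  have d_nonneg: "0 \<le> d i" if "i \<in> V" for i
    using occupation_nonneg[of 2 i] that by (auto simp: d_def)
  have d_split: "(\<Sum>i\<in>V. d i * Q i j) = Q 2 j + (\<Sum>i\<in>V - {1, 2}. u 2 i * Q i j)" for j
    by (subst sum_split_ports) (auto simp: d_def intro!: sum.cong)
  have column: "d i * Q i j = 0" if "i \<in> V" "j \<in> V - C" for i j
  proof -
    have "j \<noteq> 2" "d j = 0" using that by (auto simp: C_def d_def)
    have "(\<Sum>i\<in>V. d i * Q i j) = 0"
    proof (cases "j = 1")
      case True
      have "0 \<le> (\<Sum>i\<in>V. d i * Q i 1)"
        using ports d_nonneg Q by (intro sum_nonneg) (metis True \<open>d j = 0\<close> mult_nonneg_nonneg mult_zero_left)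
      then show ?thesis using not_pos d_split[of 1] True by (simp add: passage_rate_def)
    next
      case False
      then show ?thesis using d_split[of j] occupation_balance[of 2 j] that \<open>j \<noteq> 2\<close> by auto
    qed
    then show ?thesis
      using balanced_column_vanishes[of V j Q d i] finite_V Q d_nonneg \<open>d j = 0\<close> that by auto
  qed
  have "Q i j = 0" if "i \<in> C" "j \<in> V - C" for i j
    using column[of i j] that by (auto simp: C_def)
  moreover have "2 \<in> C" "1 \<notin> C" using ports by (auto simp: C_def d_def)
  moreover have "C \<subseteq> V" by (auto simp: C_def)
  ultimately show False
    using irred ports unfolding rates_irreducible_def by blast
qed

text \<open>
The flow into port \<open>1\<close> is a linear form in \<open>f 1\<close> and \<open>f 2\<close> with coefficient \<open>passage_rate\<close> at
\<open>f 2\<close>. It vanishes for \<open>f = \<pi>\<close>, which determines the other coefficient.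
\<close>

lemma net_flow_into_port:
  assumes "stationary_distribution V Q \<pi>"
    and "\<And>j. j \<in> V - {1, 2} \<Longrightarrow> (\<Sum>i\<in>V. f i * Q i j) = 0"
  shows "\<pi> 1 * (\<Sum>i\<in>V. f i * Q i 1) = passage_rate * (\<pi> 1 * f 2 - f 1 * \<pi> 2)"
proof -
  define out where "out = Q 1 1 + (\<Sum>i\<in>V - {1, 2}. u 1 i * Q i 1)"
  have flow: "(\<Sum>i\<in>V. g i * Q i 1) = g 1 * out + g 2 * passage_rate"
    if "\<And>j. j \<in> V - {1, 2} \<Longrightarrow> (\<Sum>i\<in>V. g i * Q i j) = 0" for g
  proof -
    have "(\<Sum>i\<in>V - {1, 2}. g i * Q i 1) = (\<Sum>i\<in>V - {1, 2}. (g 1 * u 1 i + g 2 * u 2 i) * Q i 1)"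
      using interior_from_ports[of g] that by (intro sum.cong) auto
    then show ?thesis
      by (subst sum_split_ports) (simp add: out_def passage_rate_def algebra_simps sum.distrib sum_distrib_left)
  qed
  have "\<pi> 1 * out + \<pi> 2 * passage_rate = 0"
    using flow[of \<pi>] assms(1) ports by (auto simp: stationary_distribution_def)
  then have out: "\<pi> 1 * out = - (\<pi> 2 * passage_rate)" by simp
  have "\<pi> 1 * (f 1 * out + f 2 * passage_rate) = f 1 * (\<pi> 1 * out) + \<pi> 1 * f 2 * passage_rate"
    by (simp add: algebra_simps)
  also have "\<dots> = passage_rate * (\<pi> 1 * f 2 - f 1 * \<pi> 2)"
    unfolding out by (simp add: algebra_simps)
  finally show ?thesis using flow[OF assms(2)] by simp
qed

lemma net_flow_ratio:
  assumes "stationary_distribution V Q \<pi>"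
    and "\<And>j. j \<in> V - {1, 2} \<Longrightarrow> (\<Sum>i\<in>V. f i * Q i j) = 0"
    and pos: "0 < \<pi> 1" "0 < \<pi> 2" "0 < f 2"
  shows "(\<Sum>i\<in>V. f i * Q i 1) = - (passage_rate * \<pi> 2 * f 2 / \<pi> 1 * (f 1 / f 2 - \<pi> 1 / \<pi> 2))"
proof -
  have "(\<Sum>i\<in>V. f i * Q i 1) = passage_rate * (\<pi> 1 * f 2 - f 1 * \<pi> 2) / \<pi> 1"
    using net_flow_into_port[OF assms(1,2)] pos by (simp add: nonzero_eq_divide_eq mult.commute)
  also have "\<dots> = - (passage_rate * \<pi> 2 * f 2 / \<pi> 1 * (f 1 / f 2 - \<pi> 1 / \<pi> 2))"
    using pos by (simp add: field_simps)
  finally show ?thesis .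
qed

lemma port_quotients:
  assumes \<pi>: "stationary_distribution V Q \<pi>"
    and f: "\<And>j. j \<in> V - {1, 2} \<Longrightarrow> (\<Sum>i\<in>V. f i * Q i j) = 0"
    and "\<pi> 2 * f 1 \<noteq> f 2 * \<pi> 1" "i \<in> V - {1, 2}"
  shows "u 1 i = (\<pi> 2 * f i - f 2 * \<pi> i) / (\<pi> 2 * f 1 - f 2 * \<pi> 1)"
    and "u 2 i = (\<pi> 1 * f i - f 1 * \<pi> i) / (\<pi> 1 * f 2 - f 1 * \<pi> 2)"
proof -
  have eqs: "\<pi> i = \<pi> 1 * u 1 i + \<pi> 2 * u 2 i" "f i = f 1 * u 1 i + f 2 * u 2 i"
    using \<pi> f assms(4) by (auto intro!: interior_from_ports simp: stationary_distribution_def)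
  have nz: "\<pi> 2 * f 1 - f 2 * \<pi> 1 \<noteq> 0" "\<pi> 1 * f 2 - f 1 * \<pi> 2 \<noteq> 0" using assms(3) by (auto simp: mult.commute)
  show "u 1 i = (\<pi> 2 * f i - f 2 * \<pi> i) / (\<pi> 2 * f 1 - f 2 * \<pi> 1)"
    unfolding eqs nonzero_eq_divide_eq[OF nz(1)] by (simp add: algebra_simps)
  show "u 2 i = (\<pi> 1 * f i - f 1 * \<pi> i) / (\<pi> 1 * f 2 - f 1 * \<pi> 2)"
    unfolding eqs nonzero_eq_divide_eq[OF nz(2)] by (simp add: algebra_simps)
qed

lemma ratio_bounds:
  assumes \<pi>: "stationary_distribution V Q \<pi>"
    and f: "\<And>j. j \<in> V - {1, 2} \<Longrightarrow> (\<Sum>i\<in>V. f i * Q i j) = 0"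
    and i: "i \<in> V - {1, 2}"
  shows "min (f 1 / \<pi> 1) (f 2 / \<pi> 2) \<le> f i / \<pi> i" "f i / \<pi> i \<le> max (f 1 / \<pi> 1) (f 2 / \<pi> 2)"
proof -
  have pos: "0 < \<pi> k" if "k \<in> V" for k
    using stationary_positive[OF finite_V _ irred \<pi> that] rates by (auto simp: rate_matrix_def)
  have eqs: "\<pi> i = \<pi> 1 * u 1 i + \<pi> 2 * u 2 i" "f i = f 1 * u 1 i + f 2 * u 2 i"
    using \<pi> f i by (auto intro!: interior_from_ports simp: stationary_distribution_def)
  have "0 < \<pi> 1 * u 1 i + \<pi> 2 * u 2 i" using pos[of i] i eqs(1) by simp
  moreover have "0 \<le> u 1 i" "0 \<le> u 2 i" using occupation_nonneg i by auto
  ultimately show "min (f 1 / \<pi> 1) (f 2 / \<pi> 2) \<le> f i / \<pi> i" "f i / \<pi> i \<le> max (f 1 / \<pi> 1) (f 2 / \<pi> 2)"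
    unfolding eqs using pos ports mediant_bounds[of "\<pi> 1" "\<pi> 2" "u 1 i" "u 2 i" "f 1" "f 2"] by auto
qed

end

section \<open>Hitting times of right-continuous paths\<close>

locale right_continuous_path =
  fixes X :: "real \<Rightarrow> 'w \<Rightarrow> int" and \<omega> :: 'w
  assumes rc: "\<And>t. 0 \<le> t \<Longrightarrow> continuous (at_right t) (\<lambda>u. X u \<omega>)"
begin

lemma locally_constant:
  assumes "0 \<le> t"
  shows "\<exists>d>0. \<forall>u\<in>{t..<t + d}. X u \<omega> = X t \<omega>"
proof -
  have "((\<lambda>u. X u \<omega>) \<longlongrightarrow> X t \<omega>) (at_right t)"
    using rc[OF assms] by (simp add: continuous_within)
  then have "\<forall>\<^sub>F u in at_right t. X u \<omega> = X t \<omega>"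
    unfolding tendsto_discrete .
  then obtain b where b: "t < b" "\<forall>u>t. u < b \<longrightarrow> X u \<omega> = X t \<omega>"
    unfolding eventually_at_right_field by blast
  show ?thesis
  proof (intro exI[of _ "b - t"] conjI ballI)
    fix u assume "u \<in> {t..<t + (b - t)}"
    then have "u = t \<or> (t < u \<and> u < b)" by auto
    then show "X u \<omega> = X t \<omega>" using b(2) by blast
  qed (use b in simp)
qed

text \<open>
A state is held for a positive time after it has been entered; a rational time in this holding
interval reduces events about hitting times to countably many coordinates.
\<close>

lemma rational_sample:
  assumes "0 \<le> t" "ereal t < a"
  shows "\<exists>q\<in>\<rat>. t < q \<and> ereal q < a \<and> X q \<omega> = X t \<omega>"
proof -
  obtain d where d: "0 < d" "\<forall>u\<in>{t..<t + d}. X u \<omega> = X t \<omega>"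
    using locally_constant[OF assms(1)] by blast
  obtain z where z: "ereal t < ereal z" "ereal z < a" using ereal_dense2[OF assms(2)] by blast
  obtain q where q: "q \<in> \<rat>" "t < q" "q < min z (t + d)"
    using Rats_dense_in_real[of t "min z (t + d)"] z d by auto
  have "ereal q < ereal z" using q by simp
  then have "ereal q < a" using z(2) by (rule less_trans)
  moreover have "q \<in> {t..<t + d}" using q by simp
  ultimately have "ereal q < a" "X q \<omega> = X t \<omega>" using d(2) by blast+
  then show ?thesis using q by blast
qed

lemma hitting_time_less_iff:
  assumes "X 0 \<omega> \<noteq> e"
  shows "hitting_time X e \<omega> < a \<longleftrightarrow> (\<exists>s. 0 < s \<and> X s \<omega> = e \<and> ereal s < a)"
  unfolding hitting_time_def if_not_P[OF assms] Inf_less_iff by blast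

lemma return_time_less_iff:
  assumes "X 0 \<omega> = e"
  shows "hitting_time X e \<omega> < a \<longleftrightarrow>
    (\<exists>s u. 0 < u \<and> u < s \<and> X u \<omega> \<noteq> e \<and> X s \<omega> = e \<and> ereal s < a)"
proof -
  have "(0 < s \<and> (\<exists>u\<in>{0<..<s}. X u \<omega> \<noteq> e) \<and> X s \<omega> = e) \<longleftrightarrow>
      (\<exists>u. 0 < u \<and> u < s \<and> X u \<omega> \<noteq> e \<and> X s \<omega> = e)" for s
    using less_trans by (cases "X s \<omega> = e") auto
  then show ?thesis unfolding hitting_time_def if_P[OF assms] Inf_less_iff by blast
qed

lemma hitting_less_iff:
  assumes "X 0 \<omega> \<noteq> e"
  shows "hitting_time X e \<omega> < a \<longleftrightarrow> (\<exists>q\<in>\<rat>. 0 < q \<and> ereal q < a \<and> X q \<omega> = e)"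
proof
  assume "hitting_time X e \<omega> < a"
  then obtain s where s: "0 < s" "X s \<omega> = e" "ereal s < a"
    unfolding hitting_time_less_iff[OF assms] by blast
  obtain q where "q \<in> \<rat>" "s < q" "ereal q < a" "X q \<omega> = X s \<omega>"
    using rational_sample[OF less_imp_le[OF s(1)] s(3)] by blast
  then show "\<exists>q\<in>\<rat>. 0 < q \<and> ereal q < a \<and> X q \<omega> = e"
    using s by (intro bexI[of _ q]) auto
next
  assume "\<exists>q\<in>\<rat>. 0 < q \<and> ereal q < a \<and> X q \<omega> = e"
  then show "hitting_time X e \<omega> < a" unfolding hitting_time_less_iff[OF assms] by blast
qed

lemma return_less_iff:
  assumes "X 0 \<omega> = e"
  shows "hitting_time X e \<omega> < a \<longleftrightarrow>
    (\<exists>q\<in>\<rat>. \<exists>p\<in>\<rat>. 0 < p \<and> p < q \<and> ereal q < a \<and> X p \<omega> \<noteq> e \<and> X q \<omega> = e)"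
proof
  assume "hitting_time X e \<omega> < a"
  then obtain s u where s: "0 < u" "u < s" "X u \<omega> \<noteq> e" "X s \<omega> = e" "ereal s < a"
    unfolding return_time_less_iff[OF assms] by blast
  have "0 \<le> u" "0 \<le> s" using s by auto
  obtain q where q: "q \<in> \<rat>" "s < q" "ereal q < a" "X q \<omega> = X s \<omega>"
    using rational_sample[OF \<open>0 \<le> s\<close> s(5)] by blast
  obtain p where p: "p \<in> \<rat>" "u < p" "ereal p < ereal s" "X p \<omega> = X u \<omega>"
    using rational_sample[OF \<open>0 \<le> u\<close>, of "ereal s"] s(2) by auto
  have "0 < p \<and> p < q \<and> ereal q < a \<and> X p \<omega> \<noteq> e \<and> X q \<omega> = e"
    using s q p by auto
  then show "\<exists>q\<in>\<rat>. \<exists>p\<in>\<rat>. 0 < p \<and> p < q \<and> ereal q < a \<and> X p \<omega> \<noteq> e \<and> X q \<omega> = e"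
    using q(1) p(1) by blast
next
  assume "\<exists>q\<in>\<rat>. \<exists>p\<in>\<rat>. 0 < p \<and> p < q \<and> ereal q < a \<and> X p \<omega> \<noteq> e \<and> X q \<omega> = e"
  then show "hitting_time X e \<omega> < a" unfolding return_time_less_iff[OF assms] by blast
qed

lemma hitting_time_nonneg: "0 \<le> hitting_time X e \<omega>"
  by (auto simp: hitting_time_def intro!: Inf_greatest)

text \<open>
The infimum is attained: hits at times decreasing to \<open>t\<close> force a hit at \<open>t\<close>, because the path
is constant immediately after \<open>t\<close>.
\<close>

lemma hitting_le_iff:
  assumes "X 0 \<omega> \<noteq> e" "0 \<le> t"
  shows "hitting_time X e \<omega> \<le> ereal t \<longleftrightarrow> (\<exists>s\<in>{0<..t}. X s \<omega> = e)"
proof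
  assume le: "hitting_time X e \<omega> \<le> ereal t"
  obtain d where d: "0 < d" "\<And>u. t \<le> u \<Longrightarrow> u < t + d \<Longrightarrow> X u \<omega> = X t \<omega>"
    using locally_constant[OF assms(2)] by (meson atLeastLessThan_iff)
  have "hitting_time X e \<omega> < ereal (t + d)" using le d(1) by (simp add: le_less_trans)
  then obtain s where s: "0 < s" "X s \<omega> = e" "s < t + d"
    unfolding hitting_time_less_iff[OF assms(1)] by auto
  show "\<exists>s\<in>{0<..t}. X s \<omega> = e"
  proof (cases "s \<le> t")
    case False
    then have "X t \<omega> = e" using d(2)[of s] s by simp
    moreover have "t \<noteq> 0" using assms(1) calculation by auto
    ultimately show ?thesis using assms(2) by auto
  qed (use s in auto)
next
  assume "\<exists>s\<in>{0<..t}. X s \<omega> = e"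
  then obtain s where s: "0 < s" "s \<le> t" "X s \<omega> = e" by auto
  then have "hitting_time X e \<omega> \<le> ereal s"
    using assms by (auto simp: hitting_time_def intro!: Inf_lower)
  also have "\<dots> \<le> ereal t" using s by simp
  finally show "hitting_time X e \<omega> \<le> ereal t" .
qed

lemma return_le_iff:
  assumes "X 0 \<omega> = e" "0 \<le> t"
  shows "hitting_time X e \<omega> \<le> ereal t \<longleftrightarrow>
    (\<exists>s u. 0 < u \<and> u < s \<and> s \<le> t \<and> X u \<omega> \<noteq> e \<and> X s \<omega> = e)"
proof
  assume le: "hitting_time X e \<omega> \<le> ereal t"
  obtain d where d: "0 < d" "\<And>u. t \<le> u \<Longrightarrow> u < t + d \<Longrightarrow> X u \<omega> = X t \<omega>"
    using locally_constant[OF assms(2)] by (meson atLeastLessThan_iff)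
  have "hitting_time X e \<omega> < ereal (t + d)" using le d(1) by (simp add: le_less_trans)
  then obtain s u where s: "0 < u" "u < s" "X u \<omega> \<noteq> e" "X s \<omega> = e" "s < t + d"
    unfolding return_time_less_iff[OF assms(1)] by auto
  show "\<exists>s u. 0 < u \<and> u < s \<and> s \<le> t \<and> X u \<omega> \<noteq> e \<and> X s \<omega> = e"
  proof (cases "s \<le> t")
    case False
    then have "X t \<omega> = e" using d(2)[of s] s by simp
    moreover have "u < t"
    proof (rule ccontr)
      assume "\<not> u < t"
      then have "X u \<omega> = X t \<omega>" using d(2)[of u] s by simp
      with \<open>X t \<omega> = e\<close> s(3) show False by simp
    qed
    ultimately show ?thesis using s by blast
  qed (use s in blast)
next
  assume "\<exists>s u. 0 < u \<and> u < s \<and> s \<le> t \<and> X u \<omega> \<noteq> e \<and> X s \<omega> = e"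
  then obtain s u where s: "0 < u" "u < s" "s \<le> t" "X u \<omega> \<noteq> e" "X s \<omega> = e" by blast
  then have "0 < s \<and> (\<exists>u\<in>{0<..<s}. X u \<omega> \<noteq> e) \<and> X s \<omega> = e" by auto
  then have "hitting_time X e \<omega> \<le> ereal s"
    using assms by (auto simp: hitting_time_def intro!: Inf_lower)
  also have "\<dots> \<le> ereal t" using s by simp
  finally show "hitting_time X e \<omega> \<le> ereal t" .
qed

text \<open>
If the two times agree and are finite, both are attained at the same moment, at which the path
would be in two states.
\<close>

lemma hitting_times_differ:
  assumes "X 0 \<omega> = e" "e \<noteq> g" "hitting_time X e \<omega> = hitting_time X g \<omega>"
  shows "hitting_time X g \<omega> = \<infinity>"
proof (rule ccontr)
  assume "hitting_time X g \<omega> \<noteq> \<infinity>"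
  then obtain t where t: "hitting_time X g \<omega> = ereal t" "0 \<le> t"
    using hitting_time_nonneg[of g] by (cases "hitting_time X g \<omega>") auto
  obtain s where s: "0 < s" "s \<le> t" "X s \<omega> = g"
    using hitting_le_iff[of g t] assms t by auto
  have "X t \<omega> = g"
    using hitting_le_iff[of g s] s t assms by auto
  moreover obtain r' u' where r: "0 < u'" "u' < r'" "r' \<le> t" "X u' \<omega> \<noteq> e" "X r' \<omega> = e"
    using return_le_iff[of e t] assms t by auto
  then have "0 \<le> r'" by simp
  have "hitting_time X e \<omega> \<le> ereal r'"
    using return_le_iff[OF assms(1) \<open>0 \<le> r'\<close>] r by blast
  then have "r' = t" using \<open>r' \<le> t\<close> t assms by auto
  ultimately show False using \<open>X r' \<omega> = e\<close> assms by simp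
qed

end

text \<open>
The sequence \<open>y\<close> has been in its first excursion from \<open>e\<close> up to index \<open>n\<close>: it starts with a
run of \<open>e\<close>, after which it visits neither \<open>e\<close> nor \<open>g\<close>. Such a pattern can be checked step by step.
\<close>

definition excursion_alive :: "int \<Rightarrow> int \<Rightarrow> (nat \<Rightarrow> int) \<Rightarrow> nat \<Rightarrow> bool" where
  "excursion_alive e g y n \<longleftrightarrow>
     y 0 = e \<and> (\<forall>b\<le>n. y b \<noteq> g \<and> (y b = e \<longrightarrow> (\<forall>a\<le>b. y a = e)))"

text \<open>
The index of the first multiple of \<open>h\<close> strictly after \<open>t\<close>. Sampling strictly after \<open>t\<close>, and not
before it, is what right-continuity makes harmless.
\<close>

definition next_index :: "real \<Rightarrow> real \<Rightarrow> nat" where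
  "next_index h t = Suc (nat \<lfloor>t / h\<rfloor>)"

lemma next_index_bounds:
  assumes "0 < h" "0 \<le> t"
  shows "t < h * real (next_index h t)" "h * real (next_index h t) \<le> t + h"
proof -
  have "real (nat \<lfloor>t / h\<rfloor>) = of_int \<lfloor>t / h\<rfloor>" using assms by (simp add: of_nat_nat)
  then have "t / h < real (next_index h t)" "real (next_index h t) \<le> t / h + 1"
    using floor_correct[of "t / h"] unfolding next_index_def by linarith+
  then show "t < h * real (next_index h t)" "h * real (next_index h t) \<le> t + h"
    using assms by (simp_all add: field_simps)
qed

lemma next_index_mono: "0 < h \<Longrightarrow> s \<le> t \<Longrightarrow> next_index h s \<le> next_index h t"
  by (auto simp: next_index_def intro!: nat_mono floor_mono divide_right_mono)

context right_continuous_path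
begin

lemma eventually_next_sample:
  assumes "0 \<le> t" "\<And>m. 0 < h m" "h \<longlonglongrightarrow> 0"
  shows "\<forall>\<^sub>F m in sequentially. X (h m * real (next_index (h m) t)) \<omega> = X t \<omega>"
proof -
  obtain d where d: "0 < d" "\<And>u. t \<le> u \<Longrightarrow> u < t + d \<Longrightarrow> X u \<omega> = X t \<omega>"
    using locally_constant[OF assms(1)] by (meson atLeastLessThan_iff)
  have "\<forall>\<^sub>F m in sequentially. h m < d" using assms(3) d(1) by (rule order_tendstoD)
  then show ?thesis
  proof eventually_elim
    case (elim m)
    then show ?case
      using next_index_bounds[OF assms(2)[of m] assms(1)] by (intro d(2)) auto
  qed
qed

text \<open>
If the excursion is alive at \<open>t\<close>, then it is alive slightly beyond \<open>t\<close>, and fine grids sample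
only this part of the path. If it has ended by time \<open>t\<close>, the visits that witness this (a visit to
\<open>g\<close>, or a time outside \<open>e\<close> followed by a return to \<open>e\<close>) last for positive times and are seen by
fine grids.
\<close>

lemma eventually_alive_iff:
  assumes "X 0 \<omega> = e" "e \<noteq> g" "0 \<le> t" "\<And>m. 0 < h m" "h \<longlonglongrightarrow> 0"
  shows "\<forall>\<^sub>F m in sequentially.
    excursion_alive e g (\<lambda>n. X (h m * real n) \<omega>) (next_index (h m) t) \<longleftrightarrow>
    ereal t < hitting_time X e \<omega> \<and> ereal t < hitting_time X g \<omega>"
proof (cases "ereal t < hitting_time X e \<omega> \<and> ereal t < hitting_time X g \<omega>")
  case True
  then obtain z where z: "ereal t < ereal z" "ereal z < min (hitting_time X e \<omega>) (hitting_time X g \<omega>)"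
    using ereal_dense2[of t "min (hitting_time X e \<omega>) (hitting_time X g \<omega>)"] by auto
  have tz: "t < z" "0 \<le> z" using z(1) assms(3) by auto
  have no_return: "X u \<omega> = e" if "0 \<le> u" "u < s" "s \<le> z" "X s \<omega> = e" for u s
  proof (rule ccontr)
    assume "X u \<omega> \<noteq> e"
    then have "u \<noteq> 0" using assms(1) by auto
    then have "0 < u" using that by simp
    then have "hitting_time X e \<omega> \<le> ereal z"
      using return_le_iff[OF assms(1) \<open>0 \<le> z\<close>] that \<open>X u \<omega> \<noteq> e\<close> by blast
    with z show False by auto
  qed
  have no_hit: "X s \<omega> \<noteq> g" if "0 \<le> s" "s \<le> z" for s
  proof
    assume "X s \<omega> = g"
    then have "s \<noteq> 0" using assms(1,2) by auto
    then have "hitting_time X g \<omega> \<le> ereal z"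
      using that hitting_le_iff[of g z] \<open>0 \<le> z\<close> \<open>X s \<omega> = g\<close> assms by auto
    with z show False by auto
  qed
  have "\<forall>\<^sub>F m in sequentially. h m < z - t" using assms(5) tz by (intro order_tendstoD) auto
  then show ?thesis
  proof eventually_elim
    case (elim m)
    define N where "N = next_index (h m) t"
    have "h m * real N \<le> z"
      using next_index_bounds(2)[OF assms(4) assms(3), of m] elim by (simp add: N_def)
    then have le: "0 \<le> h m * real b \<and> h m * real b \<le> z" if "b \<le> N" for b
      using assms(4)[of m] that by (smt (verit) mult_left_mono mult_nonneg_nonneg of_nat_0_le_iff of_nat_mono)
    have "excursion_alive e g (\<lambda>n. X (h m * real n) \<omega>) N"
      unfolding excursion_alive_def
    proof (intro conjI allI impI)
      show "X (h m * real 0) \<omega> = e" using assms(1) by simp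
    next
      fix b assume "b \<le> N"
      then show "X (h m * real b) \<omega> \<noteq> g" using no_hit le by blast
    next
      fix b a assume ab: "b \<le> N" "X (h m * real b) \<omega> = e" "a \<le> b"
      show "X (h m * real a) \<omega> = e"
      proof (cases "a = b")
        case False
        then have "h m * real a < h m * real b" using ab assms(4)[of m] by simp
        then show ?thesis using no_return[of "h m * real a" "h m * real b"] le ab by simp
      qed (use ab in simp)
    qed
    then show ?case using True by (simp add: N_def)
  qed
next
  case False
  have sample: "\<forall>\<^sub>F m in sequentially. X (h m * real (next_index (h m) s)) \<omega> = X s \<omega> \<and>
      next_index (h m) s \<le> next_index (h m) t" if "0 \<le> s" "s \<le> t" for s
    using eventually_next_sample[OF that(1) assms(4,5)]
    by eventually_elim (use that(2) assms(4) next_index_mono in auto)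
  from False consider "hitting_time X g \<omega> \<le> ereal t" | "hitting_time X e \<omega> \<le> ereal t" by force
  then have "\<forall>\<^sub>F m in sequentially. \<not> excursion_alive e g (\<lambda>n. X (h m * real n) \<omega>) (next_index (h m) t)"
  proof cases
    case 1
    then obtain s where s: "0 < s" "s \<le> t" "X s \<omega> = g"
      using hitting_le_iff[of g t] assms by auto
    show ?thesis
      using sample[OF less_imp_le[OF s(1)] s(2)] by eventually_elim (use s in \<open>auto simp: excursion_alive_def\<close>)
  next
    case 2
    then obtain s u where s: "0 < u" "u < s" "s \<le> t" "X u \<omega> \<noteq> e" "X s \<omega> = e"
      using return_le_iff[OF assms(1,3)] by blast
    have "0 \<le> s" "0 \<le> u" "u \<le> t" using s by auto
    show ?thesis
      using sample[OF \<open>0 \<le> s\<close> s(3)] sample[OF \<open>0 \<le> u\<close> \<open>u \<le> t\<close>]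
    proof eventually_elim
      case (elim m)
      have "next_index (h m) u \<le> next_index (h m) s" using assms(4) s next_index_mono by auto
      then show ?case using elim s unfolding excursion_alive_def by metis
    qed
  qed
  then show ?thesis by eventually_elim (use False in simp)
qed

end

section \<open>Transition probabilities\<close>

text \<open>
Events of the past are predicates of paths that depend on finitely many coordinates; the Markov
property is needed for them and not only for single prescribed pasts.
\<close>

definition determined_by :: "real set \<Rightarrow> ((real \<Rightarrow> int) \<Rightarrow> bool) \<Rightarrow> bool" where
  "determined_by J \<Phi> \<longleftrightarrow> (\<forall>f g. (\<forall>u\<in>J. f u = g u) \<longrightarrow> \<Phi> f = \<Phi> g)"

context ctmc
begin

definition transition :: "int \<Rightarrow> int \<Rightarrow> real \<Rightarrow> real" where
  "transition i j t = \<P>(\<omega> in M i. X t \<omega> = j)"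

lemma state_event:
  assumes "i \<in> V" "0 \<le> t"
  shows "{\<omega>\<in>space (M i). X t \<omega> = j} \<in> sets (M i)"
  using measurable_sets[OF random_variables[OF assms], of "{j}"]
  by (simp add: vimage_def Int_def conj_commute)

lemma cylinder_event:
  assumes "i \<in> V" "finite J" "J \<subseteq> {0..}"
  shows "{\<omega>\<in>space (M i). \<forall>u\<in>J. X u \<omega> = x u} \<in> sets (M i)"
  using assms(2,3)
proof (induction J)
  case (insert a J)
  have "{\<omega>\<in>space (M i). \<forall>u\<in>insert a J. X u \<omega> = x u} =
      {\<omega>\<in>space (M i). X a \<omega> = x a} \<inter> {\<omega>\<in>space (M i). \<forall>u\<in>J. X u \<omega> = x u}" by auto
  then show ?case using insert state_event[OF assms(1), of a "x a"] by auto
qed simp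

text \<open>
There are finitely many states, so an event of the past is a finite disjoint union of cylinders.
\<close>

lemma past_event_decomposition:
  assumes "i \<in> V" "J \<subseteq> {0..}" "determined_by J \<Phi>"
  shows "{\<omega>\<in>space (M i). \<Phi> (\<lambda>u. X u \<omega>)} =
    (\<Union>x\<in>{x\<in>J \<rightarrow>\<^sub>E V. \<Phi> x}. {\<omega>\<in>space (M i). \<forall>u\<in>J. X u \<omega> = x u})"
proof (intro set_eqI iffI)
  fix \<omega> assume \<omega>: "\<omega> \<in> {\<omega>\<in>space (M i). \<Phi> (\<lambda>u. X u \<omega>)}"
  define x where "x = restrict (\<lambda>u. X u \<omega>) J"
  have "x \<in> J \<rightarrow>\<^sub>E V" using \<omega> assms(1,2) state_space[of i _ \<omega>] by (auto simp: x_def)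
  moreover have "\<Phi> x = \<Phi> (\<lambda>u. X u \<omega>)"
    using assms(3)[unfolded determined_by_def, rule_format, of x "\<lambda>u. X u \<omega>"] by (simp add: x_def)
  moreover have "\<forall>u\<in>J. X u \<omega> = x u" by (simp add: x_def)
  ultimately show "\<omega> \<in> (\<Union>x\<in>{x\<in>J \<rightarrow>\<^sub>E V. \<Phi> x}. {\<omega>\<in>space (M i). \<forall>u\<in>J. X u \<omega> = x u})"
    using \<omega> by blast
next
  fix \<omega> assume "\<omega> \<in> (\<Union>x\<in>{x\<in>J \<rightarrow>\<^sub>E V. \<Phi> x}. {\<omega>\<in>space (M i). \<forall>u\<in>J. X u \<omega> = x u})"
  then obtain x where x: "\<Phi> x" "\<omega> \<in> space (M i)" "\<forall>u\<in>J. X u \<omega> = x u" by blast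
  then have "\<Phi> (\<lambda>u. X u \<omega>) = \<Phi> x"
    using assms(3)[unfolded determined_by_def, rule_format, of "\<lambda>u. X u \<omega>" x] by blast
  with x show "\<omega> \<in> {\<omega>\<in>space (M i). \<Phi> (\<lambda>u. X u \<omega>)}" by blast
qed

lemma past_event:
  assumes "i \<in> V" "finite J" "J \<subseteq> {0..}" "determined_by J \<Phi>"
  shows "{\<omega>\<in>space (M i). \<Phi> (\<lambda>u. X u \<omega>)} \<in> sets (M i)"
proof -
  have "finite {x\<in>J \<rightarrow>\<^sub>E V. \<Phi> x}" using assms(2) finite_states by (simp add: finite_PiE)
  then show ?thesis
    unfolding past_event_decomposition[OF assms(1,3,4)]
    using cylinder_event[OF assms(1-3)] by (intro sets.finite_UN) auto
qed

lemma measure_past_event: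
  assumes "i \<in> V" "finite J" "J \<subseteq> {0..}" "determined_by J \<Phi>" "A \<in> sets (M i)"
  shows "measure (M i) (A \<inter> {\<omega>\<in>space (M i). \<Phi> (\<lambda>u. X u \<omega>)}) =
    (\<Sum>x\<in>{x\<in>J \<rightarrow>\<^sub>E V. \<Phi> x}. measure (M i) (A \<inter> {\<omega>\<in>space (M i). \<forall>u\<in>J. X u \<omega> = x u}))"
proof -
  interpret prob_space "M i" using prob_spaces[OF assms(1)] .
  have fin: "finite {x\<in>J \<rightarrow>\<^sub>E V. \<Phi> x}" using assms(2) finite_states by (simp add: finite_PiE)
  have "x = y" if "x \<in> J \<rightarrow>\<^sub>E V" "y \<in> J \<rightarrow>\<^sub>E V" "\<forall>u\<in>J. X u \<omega> = x u" "\<forall>u\<in>J. X u \<omega> = y u" for x y \<omega>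
    using that by (intro PiE_ext[OF that(1,2)]) metis
  then have "disjoint_family_on (\<lambda>x. A \<inter> {\<omega>\<in>space (M i). \<forall>u\<in>J. X u \<omega> = x u}) {x\<in>J \<rightarrow>\<^sub>E V. \<Phi> x}"
    unfolding disjoint_family_on_def by blast
  then show ?thesis
    unfolding past_event_decomposition[OF assms(1,3,4)] Int_UN_distrib
    using cylinder_event[OF assms(1-3)] assms(5)
    by (intro finite_measure_finite_Union fin) auto
qed

text \<open>
Sum the Markov property over the cylinders of \<open>\<Phi>\<close>. Cylinders of probability zero contribute
nothing to either side.
\<close>

lemma markov_past:
  assumes "i \<in> V" "j \<in> V" "k \<in> V" "0 \<le> s" "0 \<le> t" "finite J" "J \<subseteq> {0..s}" "determined_by J \<Phi>"
  shows "\<P>(\<omega> in M i. X (s + t) \<omega> = k \<and> X s \<omega> = j \<and> \<Phi> (\<lambda>u. X u \<omega>)) =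
    \<P>(\<omega> in M i. X s \<omega> = j \<and> \<Phi> (\<lambda>u. X u \<omega>)) * transition j k t"
proof -
  interpret prob_space "M i" using prob_spaces[OF assms(1)] .
  have J: "J \<subseteq> {0..}" using assms(7) by auto
  let ?B = "{\<omega>\<in>space (M i). X s \<omega> = j}"
  let ?A = "{\<omega>\<in>space (M i). X (s + t) \<omega> = k} \<inter> ?B"
  let ?C = "\<lambda>x. {\<omega>\<in>space (M i). \<forall>u\<in>J. X u \<omega> = x u}"
  have sets: "?B \<in> sets (M i)" "?A \<in> sets (M i)"
    using state_event[OF assms(1), of s j] state_event[OF assms(1), of "s + t" k] assms(4,5) by auto
  have cylinder: "measure (M i) (?A \<inter> ?C x) = measure (M i) (?B \<inter> ?C x) * transition j k t" for x
  proof (cases "measure (M i) (?B \<inter> ?C x) = 0")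
    case True
    have "measure (M i) (?A \<inter> ?C x) \<le> measure (M i) (?B \<inter> ?C x)"
      using sets cylinder_event[OF assms(1,6) J] by (intro finite_measure_mono) auto
    with True show ?thesis by (simp add: measure_le_0_iff)
  next
    case False
    have BC: "?B \<inter> ?C x = {\<omega>\<in>space (M i). X s \<omega> = j \<and> (\<forall>u\<in>J. X u \<omega> = x u)}" by blast
    have AC: "?A \<inter> ?C x = {\<omega>\<in>space (M i). X (s + t) \<omega> = k \<and> X s \<omega> = j \<and> (\<forall>u\<in>J. X u \<omega> = x u)}" by blast
    show ?thesis
      using markov[OF assms(1-7), of x] False
      unfolding BC AC cond_prob_def transition_def by (simp add: field_simps)
  qed
  have "measure (M i) (?A \<inter> {\<omega>\<in>space (M i). \<Phi> (\<lambda>u. X u \<omega>)}) =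
      measure (M i) (?B \<inter> {\<omega>\<in>space (M i). \<Phi> (\<lambda>u. X u \<omega>)}) * transition j k t"
    unfolding measure_past_event[OF assms(1,6) J assms(8) sets(1)]
      measure_past_event[OF assms(1,6) J assms(8) sets(2)]
    by (simp add: cylinder sum_distrib_right)
  moreover have "?A \<inter> {\<omega>\<in>space (M i). \<Phi> (\<lambda>u. X u \<omega>)} =
      {\<omega>\<in>space (M i). X (s + t) \<omega> = k \<and> X s \<omega> = j \<and> \<Phi> (\<lambda>u. X u \<omega>)}" by blast
  moreover have "?B \<inter> {\<omega>\<in>space (M i). \<Phi> (\<lambda>u. X u \<omega>)} =
      {\<omega>\<in>space (M i). X s \<omega> = j \<and> \<Phi> (\<lambda>u. X u \<omega>)}" by blast
  ultimately show ?thesis by simp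
qed

lemma transition_nonneg: "0 \<le> transition i j t"
  by (simp add: transition_def)

lemma prob_sum_states:
  assumes "i \<in> V" "0 \<le> s" "{\<omega>\<in>space (M i). P \<omega>} \<in> sets (M i)"
  shows "\<P>(\<omega> in M i. P \<omega>) = (\<Sum>k\<in>V. \<P>(\<omega> in M i. P \<omega> \<and> X s \<omega> = k))"
proof -
  interpret prob_space "M i" using prob_spaces[OF assms(1)] .
  have "{\<omega>\<in>space (M i). P \<omega>} = (\<Union>k\<in>V. {\<omega>\<in>space (M i). P \<omega> \<and> X s \<omega> = k})"
    using state_space[OF assms(1,2)] by auto
  moreover have "{\<omega>\<in>space (M i). P \<omega> \<and> X s \<omega> = k} \<in> sets (M i)" for k
    using sets.Int[OF assms(3) state_event[OF assms(1,2), of k]]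
    by (simp add: Int_def conj_commute conj_left_commute cong: conj_cong)
  moreover have "disjoint_family_on (\<lambda>k. {\<omega>\<in>space (M i). P \<omega> \<and> X s \<omega> = k}) V"
    by (auto simp: disjoint_family_on_def)
  ultimately show ?thesis using finite_states by (simp add: finite_measure_finite_Union image_subset_iff)
qed

lemma transition_sum:
  assumes "i \<in> V" "0 \<le> t"
  shows "(\<Sum>k\<in>V. transition i k t) = 1"
proof -
  interpret prob_space "M i" using prob_spaces[OF assms(1)] .
  show ?thesis using prob_sum_states[OF assms, of "\<lambda>_. True"] prob_space by (simp add: transition_def)
qed

lemma chapman_kolmogorov:
  assumes "i \<in> V" "k \<in> V" "0 \<le> s" "0 \<le> t"
  shows "transition i k (s + t) = (\<Sum>j\<in>V. transition i j s * transition j k t)"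
proof -
  have "\<P>(\<omega> in M i. X (s + t) \<omega> = k \<and> X s \<omega> = j) = transition i j s * transition j k t" if "j \<in> V" for j
    using markov_past[OF assms(1) that assms(2-4), of "{}" "\<lambda>_. True"]
    by (simp add: determined_by_def transition_def)
  moreover have "transition i k (s + t) = (\<Sum>j\<in>V. \<P>(\<omega> in M i. X (s + t) \<omega> = k \<and> X s \<omega> = j))"
    unfolding transition_def using assms state_event[of i "s + t" k]
    by (intro prob_sum_states) auto
  ultimately show ?thesis by simp
qed

lemma transition_0:
  assumes "i \<in> V"
  shows "transition i j 0 = of_bool (i = j)"
proof -
  interpret prob_space "M i" using prob_spaces[OF assms] .
  have "prob {\<omega>\<in>space (M i). X 0 \<omega> = i} = 1"
    using start[OF assms] state_event[OF assms, of 0 i] by (simp add: prob_Collect_eq_1)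
  moreover have "prob {\<omega>\<in>space (M i). X 0 \<omega> = j} = 0" if "i \<noteq> j"
    using start[OF assms] state_event[OF assms, of 0 j] that by (subst prob_Collect_eq_0) (auto elim: eventually_mono)
  ultimately show ?thesis by (auto simp: transition_def)
qed

lemma transition_quotient:
  assumes "i \<in> V" "j \<in> V" "\<And>m. 0 < h m" "h \<longlonglongrightarrow> 0"
  shows "(\<lambda>m. (transition i j (h m) - of_bool (i = j)) / h m) \<longlonglongrightarrow> Q i j"
proof -
  have "((\<lambda>t. (transition i j t - of_bool (i = j)) / t) \<longlongrightarrow> Q i j) (at_right 0)"
    using transition_rates[OF assms(1,2)] transition_0[OF assms(1), of j]
    by (simp add: has_field_derivative_iff flip: transition_def)
  moreover have "filterlim h (at_right 0) sequentially"
    using assms(3,4) by (auto simp: filterlim_at less_imp_neq[symmetric])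
  ultimately show ?thesis by (rule filterlim_compose)
qed

lemma transition_small_time:
  assumes "i \<in> V" "j \<in> V" "\<And>m. 0 < h m" "h \<longlonglongrightarrow> 0"
  shows "(\<lambda>m. transition i j (h m)) \<longlonglongrightarrow> of_bool (i = j)"
proof -
  have "(\<lambda>m. (transition i j (h m) - of_bool (i = j)) / h m * h m + of_bool (i = j))
      \<longlonglongrightarrow> Q i j * 0 + of_bool (i = j)"
    by (intro tendsto_intros transition_quotient assms)
  then show ?thesis using assms(3) by (simp add: less_imp_neq[symmetric])
qed

lemma subdivision_tendsto_0: "(\<lambda>m. t / real (Suc m)) \<longlonglongrightarrow> 0"
  using LIMSEQ_Suc[OF lim_const_over_n] .

text \<open>
The probability tends to \<open>1\<close> as the time tends to \<open>0\<close>, and remaining in \<open>i\<close> at the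
end of each of \<open>m + 1\<close> short intervals is one way of being in \<open>i\<close> at time \<open>t\<close>.
\<close>

lemma transition_self_pos:
  assumes "i \<in> V" "0 \<le> t"
  shows "0 < transition i i t"
proof (cases "t = 0")
  case False
  then have "0 < t" using assms by simp
  have "(\<lambda>m. transition i i (t / real (Suc m))) \<longlonglongrightarrow> 1"
    using transition_small_time[OF assms(1,1) _ subdivision_tendsto_0, of t] \<open>0 < t\<close> by simp
  then have "\<forall>\<^sub>F m in sequentially. 0 < transition i i (t / real (Suc m))"
    by (rule order_tendstoD) simp
  then obtain m where m: "0 < transition i i (t / real (Suc m))"
    by (auto simp: eventually_sequentially)
  define h where "h = t / real (Suc m)"
  have "0 < transition i i (real n * h)" for n
  proof (induction n)
    case (Suc n)
    have "0 < transition i i (real n * h) * transition i i h" using Suc m by (simp add: h_def)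
    also have "\<dots> \<le> (\<Sum>j\<in>V. transition i j (real n * h) * transition j i h)"
      using assms finite_states transition_nonneg by (intro member_le_sum) auto
    also have "\<dots> = transition i i (real n * h + h)"
      using assms \<open>0 < t\<close> by (intro chapman_kolmogorov[symmetric]) (auto simp: h_def)
    finally show ?case by (simp add: algebra_simps)
  qed (use transition_0 assms in simp)
  from this[of "Suc m"] show ?thesis by (simp add: h_def)
qed (use transition_0 assms in simp)

text \<open>
The probability of being outside \<open>C\<close> after \<open>n\<close> steps of length \<open>t / n\<close> is at most \<open>n\<close> times the
sum over \<open>C\<close> of the one-step probabilities of leaving \<open>C\<close>. This sum is \<open>o(t / n)\<close> because its derivative at \<open>0\<close> vanishes.
\<close>

lemma closed_class_not_left:
  assumes "C \<subseteq> V" "\<And>i j. i \<in> C \<Longrightarrow> j \<in> V - C \<Longrightarrow> Q i j = 0" "i \<in> C" "j \<in> V - C" "0 \<le> t"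
  shows "transition i j t = 0"
proof (cases "t = 0")
  case False
  then have "0 < t" using assms by simp
  define leave where "leave i t = (\<Sum>j\<in>V - C. transition i j t)" for i t
  define total where "total t = (\<Sum>i\<in>C. leave i t)" for t
  have fin: "finite C" "finite (V - C)" using assms(1) finite_states finite_subset by auto
  have leave_nonneg: "0 \<le> leave i t" for i t by (simp add: leave_def sum_nonneg transition_nonneg)
  have step: "leave i (s + h) \<le> leave i s + total h" if "i \<in> C" "0 \<le> s" "0 \<le> h" for i s h
  proof -
    have "i \<in> V" using that assms by auto
    have le1: "transition i k s \<le> 1" "leave k h \<le> 1" if "k \<in> V" for k
    proof -
      have "transition i k s \<le> (\<Sum>k\<in>V. transition i k s)"
        using finite_states that transition_nonneg by (intro member_le_sum) auto
      then show "transition i k s \<le> 1" using transition_sum[OF \<open>i \<in> V\<close> \<open>0 \<le> s\<close>] by simp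
      have "leave k h \<le> (\<Sum>j\<in>V. transition k j h)"
        unfolding leave_def using finite_states transition_nonneg by (intro sum_mono2) auto
      then show "leave k h \<le> 1" using transition_sum[OF that \<open>0 \<le> h\<close>] by simp
    qed
    have "leave i (s + h) = (\<Sum>j\<in>V - C. \<Sum>k\<in>V. transition i k s * transition k j h)"
      unfolding leave_def using that \<open>i \<in> V\<close> by (intro sum.cong chapman_kolmogorov) auto
    also have "\<dots> = (\<Sum>k\<in>V. transition i k s * leave k h)"
      by (subst sum.swap) (simp add: leave_def sum_distrib_left)
    also have "\<dots> = (\<Sum>k\<in>V - C. transition i k s * leave k h) + (\<Sum>k\<in>C. transition i k s * leave k h)"
      using assms(1) finite_states by (rule sum.subset_diff)
    also have "(\<Sum>k\<in>V - C. transition i k s * leave k h) \<le> leave i s"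
      unfolding leave_def[of i s] using le1 transition_nonneg leave_nonneg
      by (intro sum_mono mult_left_le) auto
    also have "(\<Sum>k\<in>C. transition i k s * leave k h) \<le> total h"
      unfolding total_def using le1 assms(1) leave_nonneg transition_nonneg
      by (intro sum_mono mult_left_le_one_le) auto
    finally show ?thesis by simp
  qed
  have bound: "leave i (real n * h) \<le> real n * total h" if "0 \<le> h" for n h
  proof (induction n)
    case 0
    have "leave i 0 = 0" unfolding leave_def using assms transition_0 by (intro sum.neutral) auto
    then show ?case by simp
  next
    case (Suc n)
    have "leave i (real n * h + h) \<le> leave i (real n * h) + total h"
      using assms(3) that by (intro step) auto
    also have "\<dots> \<le> real (Suc n) * total h" using Suc by (simp add: algebra_simps)
    finally show ?case by (simp add: algebra_simps)
  qed
  have "(\<lambda>m. \<Sum>i\<in>C. \<Sum>j\<in>V - C. (transition i j (t / real (Suc m)) - of_bool (i = j)) / (t / real (Suc m)))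
      \<longlonglongrightarrow> (\<Sum>i\<in>C. \<Sum>j\<in>V - C. Q i j)"
    using \<open>0 < t\<close> assms(1) by (intro tendsto_sum transition_quotient subdivision_tendsto_0) auto
  also have "(\<Sum>i\<in>C. \<Sum>j\<in>V - C. Q i j) = 0" using assms(2) by (intro sum.neutral ballI) auto
  also have "(\<lambda>m. \<Sum>i\<in>C. \<Sum>j\<in>V - C. (transition i j (t / real (Suc m)) - of_bool (i = j)) / (t / real (Suc m)))
      = (\<lambda>m. total (t / real (Suc m)) / (t / real (Suc m)))"
  proof
    fix m
    have "(\<Sum>i\<in>C. \<Sum>j\<in>V - C. (transition i j (t / real (Suc m)) - of_bool (i = j)) / (t / real (Suc m)))
        = (\<Sum>i\<in>C. \<Sum>j\<in>V - C. transition i j (t / real (Suc m)) / (t / real (Suc m)))"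
      by (intro sum.cong refl) auto
    then show "(\<Sum>i\<in>C. \<Sum>j\<in>V - C. (transition i j (t / real (Suc m)) - of_bool (i = j)) / (t / real (Suc m)))
        = total (t / real (Suc m)) / (t / real (Suc m))"
      by (simp only: total_def leave_def sum_divide_distrib)
  qed
  finally have "(\<lambda>m. t * (total (t / real (Suc m)) / (t / real (Suc m)))) \<longlonglongrightarrow> t * 0"
    by (intro tendsto_intros)
  moreover have "leave i t \<le> t * (total (t / real (Suc m)) / (t / real (Suc m)))" for m
    using bound[of "t / real (Suc m)" "Suc m"] \<open>0 < t\<close> by (simp add: mult.commute)
  ultimately have "leave i t \<le> 0" by (intro LIMSEQ_le_const) auto
  then have "leave i t = 0" using leave_nonneg[of i t] by simp
  then show ?thesis
    using assms(4) fin sum_nonneg_eq_0_iff[OF fin(2), of "\<lambda>j. transition i j t"] transition_nonneg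
    by (auto simp: leave_def)
qed (use transition_0 assms in auto)

end

lemma (in irreducible_ctmc) rates_irreducible: "rates_irreducible V Q"
  unfolding rates_irreducible_def
proof (intro allI impI)
  fix C assume C: "C \<subseteq> V" "C \<noteq> {}" "\<forall>i\<in>C. \<forall>j\<in>V - C. Q i j = 0"
  show "C = V"
  proof (rule ccontr)
    assume "C \<noteq> V"
    then obtain i j where ij: "i \<in> C" "j \<in> V - C" using C by blast
    then obtain t where "0 \<le> t" "0 < transition i j t"
      using irreducible[of i j] C(1) by (auto simp: transition_def)
    with closed_class_not_left[OF C(1) _ ij] C(3) show False by auto
  qed
qed

section \<open>Excursions sampled on a time grid\<close>

text \<open>
The pairs \<open>(\<omega>, t)\<close> such that \<open>\<omega>\<close> lies in the event that belongs to the grid cell of \<open>t\<close>. Such sets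
turn sums over a time grid into areas, so that a limit of sums is a limit of measures.
\<close>

definition staircase :: "real \<Rightarrow> (nat \<Rightarrow> 'w set) \<Rightarrow> ('w \<times> real) set" where
  "staircase h E = (\<Union>n. E n \<times> {real n * h..<real (Suc n) * h})"

lemma in_step_iff:
  assumes "0 < h"
  shows "t \<in> {real n * h..<real (Suc n) * h} \<longleftrightarrow> 0 \<le> t \<and> n = nat \<lfloor>t / h\<rfloor>"
proof
  assume t: "t \<in> {real n * h..<real (Suc n) * h}"
  then have "real n \<le> t / h" "t / h < real n + 1" using assms by (simp_all add: field_simps)
  then have "\<lfloor>t / h\<rfloor> = int n" by (simp add: floor_unique)
  moreover have "0 \<le> real n * h" using assms by simp
  ultimately show "0 \<le> t \<and> n = nat \<lfloor>t / h\<rfloor>" using t by simp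
next
  assume t: "0 \<le> t \<and> n = nat \<lfloor>t / h\<rfloor>"
  then have "real n = of_int \<lfloor>t / h\<rfloor>" using assms by simp
  then have "real n \<le> t / h" "t / h < real n + 1" by linarith+
  then show "t \<in> {real n * h..<real (Suc n) * h}" using assms by (simp add: field_simps)
qed

lemma mem_staircase_iff:
  "0 < h \<Longrightarrow> (\<omega>, t) \<in> staircase h E \<longleftrightarrow> 0 \<le> t \<and> \<omega> \<in> E (nat \<lfloor>t / h\<rfloor>)"
  using in_step_iff[of h t] by (auto simp: staircase_def)

lemma staircase_measurable:
  assumes "\<And>n. E n \<in> sets M"
  shows "staircase h E \<in> sets (M \<Otimes>\<^sub>M lborel)"
  unfolding staircase_def using assms by (intro sets.countable_UN) auto

lemma emeasure_staircase:
  assumes "\<And>n. E n \<in> sets M" "0 < h"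
  shows "emeasure (M \<Otimes>\<^sub>M lborel) (staircase h E) = (\<Sum>n. emeasure M (E n) * ennreal h)"
proof -
  have "E m \<times> {real m * h..<real (Suc m) * h} \<inter> E n \<times> {real n * h..<real (Suc n) * h} = {}"
    if "m \<noteq> n" for m n
  proof -
    have "t \<notin> {real m * h..<real (Suc m) * h} \<inter> {real n * h..<real (Suc n) * h}" for t
      unfolding Int_iff in_step_iff[OF assms(2)] using that by simp
    then show ?thesis by blast
  qed
  then have "disjoint_family (\<lambda>n. E n \<times> {real n * h..<real (Suc n) * h})"
    unfolding disjoint_family_on_def by blast
  then have "emeasure (M \<Otimes>\<^sub>M lborel) (staircase h E) =
      (\<Sum>n. emeasure (M \<Otimes>\<^sub>M lborel) (E n \<times> {real n * h..<real (Suc n) * h}))"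
    unfolding staircase_def using assms(1) by (intro suminf_emeasure[symmetric]) auto
  moreover have "emeasure (M \<Otimes>\<^sub>M lborel) (E n \<times> {real n * h..<real (Suc n) * h}) = emeasure M (E n) * ennreal h" for n
    using assms by (subst lborel.emeasure_pair_measure_Times) (auto simp: algebra_simps)
  ultimately show ?thesis by (simp only:)
qed

context ctmc
begin

lemma right_continuous_sample_path: "i \<in> V \<Longrightarrow> \<omega> \<in> space (M i) \<Longrightarrow> right_continuous_path X \<omega>"
  by unfold_locales (rule right_continuous)

text \<open>
By \<open>hitting_less_iff\<close> and \<open>return_less_iff\<close>, whether the time is below \<open>c\<close> depends on the path at
time \<open>0\<close> and at rational times only.
\<close>

lemma hitting_time_measurable:
  assumes "i \<in> V"
  shows "hitting_time X a \<in> borel_measurable (M i)"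
  unfolding borel_measurable_ereal_iff_Iio
proof
  fix c :: ereal
  let ?S = "\<lambda>q b. {\<omega>\<in>space (M i). X q \<omega> = b}"
  let ?R = "\<lambda>b. {q\<in>\<rat>. 0 < q \<and> ereal q < b}"
  have S: "?S q b \<in> sets (M i)" if "0 \<le> q" for q b using state_event[OF assms that] .
  let ?P = "\<lambda>q. {p\<in>\<rat>. 0 < p \<and> p < q}"
  have count: "countable (?R c)" "countable (?P q)" for q
    using countable_rat by (auto intro: countable_subset[rotated])
  have "hitting_time X a -` {..<c} \<inter> space (M i) =
      ((space (M i) - ?S 0 a) \<inter> (\<Union>q\<in>?R c. ?S q a)) \<union>
      (?S 0 a \<inter> (\<Union>q\<in>?R c. \<Union>p\<in>?P q. (space (M i) - ?S p a) \<inter> ?S q a))"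
    (is "_ = ?hit \<union> ?return")
  proof (intro set_eqI)
    fix \<omega>
    show "\<omega> \<in> hitting_time X a -` {..<c} \<inter> space (M i) \<longleftrightarrow> \<omega> \<in> ?hit \<union> ?return"
    proof (cases "\<omega> \<in> space (M i)")
      case True
      then interpret right_continuous_path X \<omega> using right_continuous_sample_path[OF assms] by blast
      show ?thesis
      proof (cases "X 0 \<omega> = a")
        case start: True
        have "\<omega> \<in> ?return \<longleftrightarrow> (\<exists>q\<in>\<rat>. \<exists>p\<in>\<rat>. 0 < p \<and> p < q \<and> ereal q < c \<and> X p \<omega> \<noteq> a \<and> X q \<omega> = a)"
          using True start less_trans[of 0] by blast
        moreover have "\<omega> \<notin> ?hit" using True start by blast
        ultimately show ?thesis using True return_less_iff[OF start, of c] by blast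
      next
        case start: False
        have "\<omega> \<in> ?hit \<longleftrightarrow> (\<exists>q\<in>\<rat>. 0 < q \<and> ereal q < c \<and> X q \<omega> = a)"
          using True start by blast
        moreover have "\<omega> \<notin> ?return" using True start by blast
        ultimately show ?thesis using True hitting_less_iff[OF start, of c] by blast
      qed
    qed auto
  qed
  also have "\<dots> \<in> sets (M i)"
    using S count by (intro sets.Un sets.Int sets.Diff sets.countable_UN'' sets.top) auto
  finally show "hitting_time X a -` {..<c} \<inter> space (M i) \<in> sets (M i)" .
qed

definition avoid_event :: "int \<Rightarrow> int \<Rightarrow> real \<Rightarrow> nat \<Rightarrow> 'w set" where
  "avoid_event i g T n = {\<omega>\<in>space (M i). \<forall>b\<le>n. X (T * real b) \<omega> \<noteq> g}"

lemma determined_by_avoid: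
  "determined_by ((\<lambda>b. T * real b) ` {..n}) (\<lambda>f. \<forall>b\<le>n. f (T * real b) \<noteq> g)"
  unfolding determined_by_def by auto

lemma avoid_event_measurable: "i \<in> V \<Longrightarrow> 0 < T \<Longrightarrow> avoid_event i g T n \<in> sets (M i)"
  unfolding avoid_event_def by (rule past_event[OF _ _ _ determined_by_avoid]) auto

text \<open>
From every state, \<open>g\<close> is reached in the next step with probability at least \<open>c\<close>.
\<close>

lemma avoid_probability_bound:
  assumes "i \<in> V" "g \<in> V" "0 < T" "\<And>k. k \<in> V \<Longrightarrow> c \<le> transition k g T" "c \<le> 1"
  shows "measure (M i) (avoid_event i g T n) \<le> (1 - c) ^ n"
proof (induction n)
  case 0
  interpret prob_space "M i" using prob_spaces[OF assms(1)] .
  show ?case by simp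
next
  case (Suc n)
  interpret prob_space "M i" using prob_spaces[OF assms(1)] .
  let ?s = "T * real n"
  let ?\<Phi> = "\<lambda>f. \<forall>b\<le>n. f (T * real b) \<noteq> g"
  let ?A = "\<lambda>k. {\<omega>\<in>space (M i). ?\<Phi> (\<lambda>u. X u \<omega>) \<and> X ?s \<omega> = k}"
  let ?G = "{\<omega>\<in>space (M i). X (?s + T) \<omega> = g}"
  have D: "avoid_event i g T n \<in> sets (M i)" for n using avoid_event_measurable assms by blast
  have s: "0 \<le> ?s" using assms(3) by simp
  have G: "?G \<in> sets (M i)" using assms(1,3) by (intro state_event) auto
  have A: "?A k \<in> sets (M i)" for k
    using sets.Int[OF D[of n] state_event[OF assms(1) s, of k]]
    by (simp add: avoid_event_def Int_def conj_ac cong: conj_cong)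
  have J: "(\<lambda>b. T * real b) ` {..n} \<subseteq> {0..?s}"
    using assms(3) by auto
  have split: "prob (avoid_event i g T n) = (\<Sum>k\<in>V. prob (?A k))"
    using prob_sum_states[OF assms(1) s D[of n, unfolded avoid_event_def]]
    unfolding avoid_event_def .
  have "avoid_event i g T (Suc n) = {\<omega>\<in>space (M i). ?\<Phi> (\<lambda>u. X u \<omega>) \<and> X (?s + T) \<omega> \<noteq> g}"
    unfolding avoid_event_def by (auto simp: le_Suc_eq algebra_simps)
  then have "prob (avoid_event i g T (Suc n)) =
      (\<Sum>k\<in>V. prob {\<omega>\<in>space (M i). (?\<Phi> (\<lambda>u. X u \<omega>) \<and> X (?s + T) \<omega> \<noteq> g) \<and> X ?s \<omega> = k})"
    using prob_sum_states[OF assms(1) s, of "\<lambda>\<omega>. ?\<Phi> (\<lambda>u. X u \<omega>) \<and> X (?s + T) \<omega> \<noteq> g"] D[of "Suc n"]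
    by (simp only:)
  also have "\<dots> = (\<Sum>k\<in>V. prob (?A k - ?G))"
    by (intro sum.cong refl arg_cong[where f = prob]) blast
  also have "\<dots> \<le> (\<Sum>k\<in>V. (1 - c) * prob (?A k))"
  proof (intro sum_mono)
    fix k assume k: "k \<in> V"
    have "prob (?A k \<inter> ?G) = prob (?A k) * transition k g T"
      using markov_past[OF assms(1) k assms(2) s less_imp_le[OF assms(3)] _ J determined_by_avoid, of g]
      by (simp add: Int_def conj_ac cong: conj_cong)
    moreover have "prob (?A k - ?G) = prob (?A k) - prob (?A k \<inter> ?G)"
      using A G by (rule finite_measure_Diff')
    ultimately have "prob (?A k - ?G) = (1 - transition k g T) * prob (?A k)"
      by (simp add: algebra_simps)
    also have "\<dots> \<le> (1 - c) * prob (?A k)"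
      using assms(4)[OF k] by (intro mult_right_mono) auto
    finally show "prob (?A k - ?G) \<le> (1 - c) * prob (?A k)" .
  qed
  also have "\<dots> = (1 - c) * prob (avoid_event i g T n)"
    by (simp add: split sum_distrib_left)
  also have "\<dots> \<le> (1 - c) * (1 - c) ^ n"
    using Suc assms(5) by (intro mult_left_mono) auto
  finally show ?case by simp
qed

definition alive_event :: "int \<Rightarrow> int \<Rightarrow> real \<Rightarrow> int \<Rightarrow> nat \<Rightarrow> 'w set" where
  "alive_event e g h k n =
     {\<omega>\<in>space (M e). excursion_alive e g (\<lambda>b. X (h * real b) \<omega>) n \<and> X (h * real n) \<omega> = k}"

lemma excursion_alive_cong:
  assumes "\<And>b. b \<le> n \<Longrightarrow> y b = z b"
  shows "excursion_alive e g y n = excursion_alive e g z n"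
proof -
  have "(\<forall>a\<le>b. y a = e) = (\<forall>a\<le>b. z a = e)" if "b \<le> n" for b
    using assms that by (metis le_trans)
  then show ?thesis
    unfolding excursion_alive_def using assms by (metis le0)
qed

lemma determined_by_alive:
  "determined_by ((\<lambda>b. h * real b) ` {..n}) (\<lambda>f. excursion_alive e g (\<lambda>b. f (h * real b)) n)"
  unfolding determined_by_def by (intro allI impI excursion_alive_cong) auto

lemma alive_event_measurable:
  assumes "e \<in> V" "0 < h"
  shows "alive_event e g h k n \<in> sets (M e)"
proof -
  have "{\<omega>\<in>space (M e). excursion_alive e g (\<lambda>b. X (h * real b) \<omega>) n} \<in> sets (M e)"
    using assms by (intro past_event[OF _ _ _ determined_by_alive]) auto
  moreover have "{\<omega>\<in>space (M e). X (h * real n) \<omega> = k} \<in> sets (M e)"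
    using assms by (intro state_event) auto
  ultimately have "{\<omega>\<in>space (M e). excursion_alive e g (\<lambda>b. X (h * real b) \<omega>) n} \<inter>
      {\<omega>\<in>space (M e). X (h * real n) \<omega> = k} \<in> sets (M e)" by (rule sets.Int)
  then show ?thesis by (simp add: alive_event_def Int_def conj_ac cong: conj_cong)
qed

text \<open>
The only information about the past needed to decide whether the excursion continues is the
current state: a sample equal to \<open>e\<close> can only be preceded by \<open>e\<close>.
\<close>

lemma excursion_alive_Suc:
  assumes "j \<noteq> g"
  shows "excursion_alive e g y (Suc n) \<and> y (Suc n) = j \<longleftrightarrow>
    excursion_alive e g y n \<and> y (Suc n) = j \<and> (j = e \<longrightarrow> y n = e)"
proof -
  have "excursion_alive e g y (Suc n) \<longleftrightarrow>
      excursion_alive e g y n \<and> y (Suc n) \<noteq> g \<and> (y (Suc n) = e \<longrightarrow> (\<forall>a\<le>Suc n. y a = e))"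
    unfolding excursion_alive_def by (metis le_Suc_eq)
  moreover have "(\<forall>a\<le>Suc n. y a = e) \<longleftrightarrow> y n = e"
    if "excursion_alive e g y n" "y (Suc n) = e"
    using that unfolding excursion_alive_def by (metis le_Suc_eq order_refl)
  ultimately show ?thesis using assms by blast
qed

text \<open>
This is the transition matrix of the sampled chain in which the transitions back to \<open>e\<close> and the
transitions to \<open>g\<close> have been removed.
\<close>

lemma alive_recursion:
  assumes "e \<in> V" "g \<in> V" "j \<in> V" "j \<noteq> g" "0 < h"
  shows "measure (M e) (alive_event e g h j (Suc n)) =
    (\<Sum>k\<in>V - {g}. measure (M e) (alive_event e g h k n) * (if j = e \<and> k \<noteq> e then 0 else transition k j h))"
proof -
  interpret prob_space "M e" using prob_spaces[OF assms(1)] .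
  let ?s = "h * real n"
  let ?\<Phi> = "\<lambda>f. excursion_alive e g (\<lambda>b. f (h * real b)) n"
  have s: "0 \<le> ?s" using assms(5) by simp
  have J: "(\<lambda>b. h * real b) ` {..n} \<subseteq> {0..?s}" using assms(5) by auto
  have "alive_event e g h j (Suc n) = {\<omega>\<in>space (M e).
      X (?s + h) \<omega> = j \<and> (j = e \<longrightarrow> X ?s \<omega> = e) \<and> ?\<Phi> (\<lambda>u. X u \<omega>)}" (is "_ = ?E")
  proof -
    have "h * real (Suc n) = ?s + h" by (simp add: algebra_simps)
    then have "excursion_alive e g (\<lambda>b. X (h * real b) \<omega>) (Suc n) \<and> X (h * real (Suc n)) \<omega> = j \<longleftrightarrow>
        X (?s + h) \<omega> = j \<and> (j = e \<longrightarrow> X ?s \<omega> = e) \<and> ?\<Phi> (\<lambda>u. X u \<omega>)" for \<omega>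
      using excursion_alive_Suc[OF assms(4), of e "\<lambda>b. X (h * real b) \<omega>" n] by metis
    then show ?thesis unfolding alive_event_def by blast
  qed
  then have "prob (alive_event e g h j (Suc n)) = (\<Sum>k\<in>V. prob {\<omega>\<in>space (M e).
      (X (?s + h) \<omega> = j \<and> (j = e \<longrightarrow> X ?s \<omega> = e) \<and> ?\<Phi> (\<lambda>u. X u \<omega>)) \<and> X ?s \<omega> = k})"
    using prob_sum_states[OF assms(1) s, of "\<lambda>\<omega>. X (?s + h) \<omega> = j \<and> (j = e \<longrightarrow> X ?s \<omega> = e) \<and> ?\<Phi> (\<lambda>u. X u \<omega>)"]
      alive_event_measurable[OF assms(1,5), of g j "Suc n"] by (simp only:)
  also have "\<dots> = (\<Sum>k\<in>V. prob (alive_event e g h k n) * (if j = e \<and> k \<noteq> e then 0 else transition k j h))"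
  proof (intro sum.cong refl)
    fix k assume k: "k \<in> V"
    show "prob {\<omega>\<in>space (M e).
        (X (?s + h) \<omega> = j \<and> (j = e \<longrightarrow> X ?s \<omega> = e) \<and> ?\<Phi> (\<lambda>u. X u \<omega>)) \<and> X ?s \<omega> = k} =
      prob (alive_event e g h k n) * (if j = e \<and> k \<noteq> e then 0 else transition k j h)"
    proof (cases "j = e \<and> k \<noteq> e")
      case True
      then have none: "{\<omega>\<in>space (M e).
        (X (?s + h) \<omega> = j \<and> (j = e \<longrightarrow> X ?s \<omega> = e) \<and> ?\<Phi> (\<lambda>u. X u \<omega>)) \<and> X ?s \<omega> = k} = {}" by auto
      show ?thesis unfolding none using True by simp
    next
      case False
      then have markov_form: "{\<omega>\<in>space (M e).
        (X (?s + h) \<omega> = j \<and> (j = e \<longrightarrow> X ?s \<omega> = e) \<and> ?\<Phi> (\<lambda>u. X u \<omega>)) \<and> X ?s \<omega> = k} =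
        {\<omega>\<in>space (M e). X (?s + h) \<omega> = j \<and> X ?s \<omega> = k \<and> ?\<Phi> (\<lambda>u. X u \<omega>)}" by auto
      have alive: "{\<omega>\<in>space (M e). X ?s \<omega> = k \<and> ?\<Phi> (\<lambda>u. X u \<omega>)} = alive_event e g h k n"
        unfolding alive_event_def by blast
      show ?thesis
        using markov_past[OF assms(1) k assms(3) s less_imp_le[OF assms(5)] finite_imageI[OF finite_atMost]
            J determined_by_alive, of e g] False
        unfolding markov_form alive by auto
    qed
  qed
  also have "\<dots> = (\<Sum>k\<in>V - {g}. prob (alive_event e g h k n) * (if j = e \<and> k \<noteq> e then 0 else transition k j h))"
  proof -
    have "alive_event e g h g n = {}" by (auto simp: alive_event_def excursion_alive_def)
    then show ?thesis using finite_states by (simp add: sum.remove[OF finite_states assms(2)])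
  qed
  finally show ?thesis .
qed

lemma alive_initial:
  assumes "e \<in> V" "e \<noteq> g"
  shows "measure (M e) (alive_event e g h k 0) = of_bool (k = e)"
proof -
  have "alive_event e g h k 0 = (if k = e then {\<omega>\<in>space (M e). X 0 \<omega> = e} else {})"
    using assms(2) by (auto simp: alive_event_def excursion_alive_def)
  then show ?thesis using transition_0[OF assms(1), of e] by (simp add: transition_def)
qed

end

section \<open>Refining the grid\<close>

context irreducible_ctmc
begin

text \<open>
Some time is good for each \<open>k\<close>; waiting in \<open>g\<close> for the rest of a common time bound keeps the
probability positive.
\<close>

lemma uniform_positive_transition:
  assumes "g \<in> V"
  obtains T c where "0 < T" "0 < c" "c \<le> 1" "\<And>k. k \<in> V \<Longrightarrow> c \<le> transition k g T"
proof -
  have "\<forall>k\<in>V. \<exists>t\<ge>0. 0 < transition k g t"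
    using irreducible[OF _ assms] by (simp add: transition_def)
  then obtain u where u: "\<And>k. k \<in> V \<Longrightarrow> 0 \<le> u k" "\<And>k. k \<in> V \<Longrightarrow> 0 < transition k g (u k)"
    by metis
  \<comment> \<open>A bound on all \<open>u k\<close>; the summand \<open>1\<close> makes it positive.\<close>
  define T where "T = 1 + (\<Sum>k\<in>V. u k)"
  have le: "u k \<le> T" if "k \<in> V" for k
    using member_le_sum[of k V u] u finite_states that by (simp add: T_def add_increasing)
  have pos: "0 < transition k g T" if k: "k \<in> V" for k
  proof -
    have "0 < transition k g (u k) * transition g g (T - u k)"
      using u[OF k] transition_self_pos[OF assms] le[OF k] by simp
    also have "\<dots> \<le> (\<Sum>j\<in>V. transition k j (u k) * transition j g (T - u k))"
      using finite_states transition_nonneg assms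
      by (intro member_le_sum[where f = "\<lambda>j. transition k j (u k) * transition j g (T - u k)"]) auto
    also have "\<dots> = transition k g T"
      using chapman_kolmogorov[OF k assms u(1)[OF k], of "T - u k"] le[OF k] by simp
    finally show ?thesis .
  qed
  define c where "c = Min ((\<lambda>k. transition k g T) ` V)"
  have fin: "finite ((\<lambda>k. transition k g T) ` V)" "(\<lambda>k. transition k g T) ` V \<noteq> {}"
    using finite_states assms by auto
  have c: "c \<le> transition k g T" if "k \<in> V" for k
    unfolding c_def using fin(1) that by (intro Min_le) auto
  have "0 \<le> (\<Sum>k\<in>V. u k)" using u by (intro sum_nonneg) auto
  then have T: "0 < T" by (simp add: T_def)
  have "transition g g T \<le> (\<Sum>k\<in>V. transition g k T)"
    using finite_states transition_nonneg assms by (intro member_le_sum) auto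
  then have "c \<le> 1" using c[OF assms] transition_sum[OF assms less_imp_le[OF T]] by simp
  moreover have "0 < c" unfolding c_def using fin pos by (subst Min_gr_iff) auto
  ultimately show thesis using T c by (rule_tac that)
qed

text \<open>
In product with Lebesgue measure, the section at \<open>\<omega>\<close> has as length the time that \<open>\<omega>\<close> spends in
\<open>k\<close> during its first excursion from \<open>e\<close>.
\<close>

definition excursion_region :: "int \<Rightarrow> int \<Rightarrow> int \<Rightarrow> ('a \<times> real) set" where
  "excursion_region e g k = {(\<omega>, t). \<omega> \<in> space (M e) \<and> X 0 \<omega> = e \<and> 0 \<le> t \<and>
     ereal t < hitting_time X e \<omega> \<and> ereal t < hitting_time X g \<omega> \<and> X t \<omega> = k}"

definition excursion_mass :: "int \<Rightarrow> int \<Rightarrow> int \<Rightarrow> real" where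
  "excursion_mass e g k = measure (M e \<Otimes>\<^sub>M lborel) (excursion_region e g k)"

lemma indicator_staircase_tendsto:
  assumes "e \<in> V" "e \<noteq> g" "\<And>m. 0 < h m" "h \<longlonglongrightarrow> 0" "\<omega> \<in> space (M e)"
  shows "(\<lambda>m. indicator (staircase (h m) (\<lambda>n. alive_event e g (h m) k (Suc n))) (\<omega>, t) :: real)
    \<longlonglongrightarrow> indicator (excursion_region e g k) (\<omega>, t)"
proof -
  interpret right_continuous_path X \<omega> using right_continuous_sample_path[OF assms(1,5)] .
  have W: "(\<omega>, t) \<in> staircase (h m) (\<lambda>n. alive_event e g (h m) k (Suc n)) \<longleftrightarrow>
      0 \<le> t \<and> excursion_alive e g (\<lambda>n. X (h m * real n) \<omega>) (next_index (h m) t) \<and>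
      X (h m * real (next_index (h m) t)) \<omega> = k" for m
    unfolding mem_staircase_iff[OF assms(3)] alive_event_def next_index_def using assms(5) by blast
  have "\<forall>\<^sub>F m in sequentially.
      (\<omega>, t) \<in> staircase (h m) (\<lambda>n. alive_event e g (h m) k (Suc n)) \<longleftrightarrow> (\<omega>, t) \<in> excursion_region e g k"
  proof (cases "0 \<le> t \<and> X 0 \<omega> = e")
    case True
    have "\<forall>\<^sub>F m in sequentially.
        excursion_alive e g (\<lambda>n. X (h m * real n) \<omega>) (next_index (h m) t) \<longleftrightarrow>
        ereal t < hitting_time X e \<omega> \<and> ereal t < hitting_time X g \<omega>"
      using True assms(2-4) by (intro eventually_alive_iff) auto
    moreover have "\<forall>\<^sub>F m in sequentially. X (h m * real (next_index (h m) t)) \<omega> = X t \<omega>"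
      using True assms(3,4) by (intro eventually_next_sample) auto
    ultimately show ?thesis
      by eventually_elim (use True assms(5) in \<open>auto simp: W excursion_region_def\<close>)
  next
    case False
    then show ?thesis
      unfolding W excursion_region_def excursion_alive_def by (intro always_eventually) auto
  qed
  then show ?thesis by (intro tendsto_eventually) (auto elim!: eventually_mono simp: indicator_def)
qed

text \<open>
The step sizes divide \<open>T\<close>, so every grid contains the multiples of \<open>T\<close>. An excursion that is alive
on any of these grids avoids \<open>g\<close> at the multiples of \<open>T\<close>, and by \<open>avoid_probability_bound\<close> this
has geometrically decaying probability. The staircase of the latter events dominates all sampled
regions at once and has finite area.
\<close>

lemma sampled_excursion:
  fixes T :: real
  defines "h \<equiv> \<lambda>m. T / real (Suc m)"
  assumes "e \<in> V" "g \<in> V" "e \<noteq> g" "0 < T"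
    and c: "0 < c" "c \<le> 1" "\<And>k. k \<in> V \<Longrightarrow> c \<le> transition k g T"
  shows excursion_region_measurable: "excursion_region e g k \<in> sets (M e \<Otimes>\<^sub>M lborel)"
    and excursion_region_finite: "emeasure (M e \<Otimes>\<^sub>M lborel) (excursion_region e g k) < \<infinity>"
    and summable_alive: "summable (\<lambda>n. measure (M e) (alive_event e g (h m) k (Suc n)))"
    and sampled_mass_tendsto: "(\<lambda>m. h m * (\<Sum>n. measure (M e) (alive_event e g (h m) k (Suc n))))
      \<longlonglongrightarrow> excursion_mass e g k"
proof -
  interpret prob_space "M e" using prob_spaces[OF assms(2)] .
  let ?N = "M e \<Otimes>\<^sub>M lborel"
  define D where "D = staircase T (avoid_event e g T)"
  define W where "W m = staircase (h m) (\<lambda>n. alive_event e g (h m) k (Suc n))" for m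
  have h: "0 < h m" for m using assms(5) by (simp add: h_def)
  have h0: "h \<longlonglongrightarrow> 0" unfolding h_def by (rule subdivision_tendsto_0)
  have avoid: "avoid_event e g T n \<in> sets (M e)" for n using avoid_event_measurable assms by blast
  have alive: "alive_event e g (h m) k (Suc n) \<in> sets (M e)" for m n
    using alive_event_measurable[OF assms(2) h] .
  have D: "D \<in> sets ?N" unfolding D_def using avoid by (rule staircase_measurable)
  have W: "W m \<in> sets ?N" for m unfolding W_def using alive by (rule staircase_measurable)
  have "summable (\<lambda>n. (1 - c) ^ n)" using c by (intro summable_geometric) auto
  then have sum_avoid: "summable (\<lambda>n. prob (avoid_event e g T n))"
    by (rule summable_comparison_test'[where N = 0])
      (use avoid_probability_bound[OF assms(2,3,5) c(3,2)] in simp)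
  have "emeasure ?N D = (\<Sum>n. ennreal (prob (avoid_event e g T n) * T))"
    unfolding D_def emeasure_staircase[OF avoid assms(5)]
    using assms(5) by (intro suminf_cong) (simp add: emeasure_eq_measure ennreal_mult)
  also have "\<dots> < \<infinity>"
    using sum_avoid assms(5) by (subst suminf_ennreal2) (auto intro: summable_mult2)
  finally have D_finite: "emeasure ?N D < \<infinity>" .
  have W_sub: "W m \<subseteq> D" for m
  proof clarify
    fix \<omega> t assume "(\<omega>, t) \<in> W m"
    then have t: "0 \<le> t" "\<omega> \<in> space (M e)"
      and alive: "excursion_alive e g (\<lambda>n. X (h m * real n) \<omega>) (Suc (nat \<lfloor>t / h m\<rfloor>))"
      unfolding W_def mem_staircase_iff[OF h] alive_event_def by auto
    have "X (T * real b) \<omega> \<noteq> g" if "b \<le> nat \<lfloor>t / T\<rfloor>" for b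
    proof -
      have "real b \<le> t / T" using that t assms(5) by (simp add: le_nat_floor le_nat_iff le_floor_iff)
      then have "real (Suc m) * real b \<le> real (Suc m) * (t / T)"
        by (rule mult_left_mono) simp
      then have "real (Suc m * b) \<le> t / h m"
        unfolding of_nat_mult h_def by (simp add: mult.commute del: of_nat_Suc)
      then have "Suc m * b \<le> Suc (nat \<lfloor>t / h m\<rfloor>)" by (intro le_SucI le_nat_floor)
      then have "X (h m * real (Suc m * b)) \<omega> \<noteq> g"
        using alive unfolding excursion_alive_def by blast
      moreover have "h m * real (Suc m * b) = T * real b"
        unfolding of_nat_mult h_def by (simp del: of_nat_Suc)
      ultimately show ?thesis by simp
    qed
    then show "(\<omega>, t) \<in> D"
      unfolding D_def mem_staircase_iff[OF assms(5)] avoid_event_def using t by blast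
  qed
  have lim: "(\<lambda>m. indicator (W m) z :: real) \<longlonglongrightarrow> indicator (excursion_region e g k) z"
    if "z \<in> space ?N" for z
  proof (cases z)
    case (Pair \<omega> t)
    then have "\<omega> \<in> space (M e)" using that by (auto simp: space_pair_measure)
    then show ?thesis
      unfolding Pair W_def by (intro indicator_staircase_tendsto assms h h0)
  qed
  have region_meas: "(indicator (excursion_region e g k) :: _ \<Rightarrow> real) \<in> borel_measurable ?N"
    by (rule borel_measurable_LIMSEQ_real[OF lim]) (use W in simp_all)
  moreover have "excursion_region e g k \<subseteq> space ?N"
    by (auto simp: excursion_region_def space_pair_measure)
  ultimately show meas: "excursion_region e g k \<in> sets ?N"
    by (simp add: borel_measurable_indicator_iff Int_absorb2)
  \<comment> \<open>A point of the limit region lies in some sampled region and hence in the dominating staircase.\<close>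
  have "z \<in> D" if z: "z \<in> excursion_region e g k" for z
  proof -
    have "z \<in> space ?N" using sets.sets_into_space[OF meas] z by blast
    from lim[OF this] have "\<forall>\<^sub>F m in sequentially. 0 < (indicator (W m) z :: real)"
      using z by (intro order_tendstoD) auto
    then obtain m where "0 < (indicator (W m) z :: real)" by (auto simp: eventually_sequentially)
    then have "z \<in> W m" by (simp add: indicator_def split: if_splits)
    then show ?thesis using W_sub by blast
  qed
  then have "emeasure ?N (excursion_region e g k) \<le> emeasure ?N D"
    using D by (intro emeasure_mono) auto
  then show "emeasure ?N (excursion_region e g k) < \<infinity>" using D_finite by (rule le_less_trans)
  have W_emeasure: "emeasure ?N (W m) = (\<Sum>n. ennreal (prob (alive_event e g (h m) k (Suc n)) * h m))" for m
    unfolding W_def emeasure_staircase[OF alive h]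
    using h[of m] by (intro suminf_cong) (simp add: emeasure_eq_measure ennreal_mult)
  have W_finite: "emeasure ?N (W m) < \<infinity>" for m
    using emeasure_mono[OF W_sub D] D_finite by (rule le_less_trans)
  have summable_scaled: "summable (\<lambda>n. prob (alive_event e g (h m) k (Suc n)) * h m)" for m
    using W_finite[of m] h[of m] unfolding W_emeasure by (intro summable_suminf_not_top) auto
  show summable: "summable (\<lambda>n. prob (alive_event e g (h m) k (Suc n)))" for m
    using summable_divide[OF summable_scaled[of m], of "h m"] h[of m] by simp
  have W_measure: "measure ?N (W m) = h m * (\<Sum>n. prob (alive_event e g (h m) k (Suc n)))" for m
  proof -
    have "emeasure ?N (W m) = ennreal (\<Sum>n. prob (alive_event e g (h m) k (Suc n)) * h m)"
      unfolding W_emeasure using h[of m] by (intro suminf_ennreal2 summable_scaled) auto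
    then have "measure ?N (W m) = (\<Sum>n. prob (alive_event e g (h m) k (Suc n)) * h m)"
      using h[of m] by (intro measure_eq_emeasure_eq_ennreal suminf_nonneg summable_scaled) auto
    then show ?thesis using suminf_mult2[OF summable[of m], of "h m"] by (simp add: mult.commute)
  qed
  have "(\<lambda>m. integral\<^sup>L ?N (indicator (W m))) \<longlonglongrightarrow> integral\<^sup>L ?N (indicator (excursion_region e g k) :: _ \<Rightarrow> real)"
  proof (rule integral_dominated_convergence[where w = "indicator D"])
    show "integrable ?N (indicator D :: _ \<Rightarrow> real)" using D D_finite by simp
    show "AE z in ?N. (\<lambda>m. indicator (W m) z :: real) \<longlonglongrightarrow> indicator (excursion_region e g k) z"
      using lim by (rule AE_I2)
    show "AE z in ?N. norm (indicator (W m) z :: real) \<le> indicator D z" for m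
      using W_sub[of m] by (intro AE_I2) (auto simp: indicator_def)
  qed (use W region_meas in auto)
  moreover have "space ?N \<inter> W m = W m" "space ?N \<inter> excursion_region e g k = excursion_region e g k" for m
    using sets.sets_into_space[OF W] sets.sets_into_space[OF meas] by blast+
  ultimately show "(\<lambda>m. h m * (\<Sum>n. prob (alive_event e g (h m) k (Suc n)))) \<longlonglongrightarrow> excursion_mass e g k"
    using W meas by (simp add: excursion_mass_def W_measure Int_commute)
qed

text \<open>
Summing \<open>alive_recursion\<close> over all steps expresses the sampled masses through themselves.
Subtracting and dividing by the step size turns the transition probabilities into difference
quotients. For \<open>j \<noteq> e\<close> the limit is the balance equation, with the holding time in \<open>e\<close> as a
source; for \<open>e\<close> itself it says that the mean holding time is the inverse of the rate of leaving.
\<close>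

lemma excursion_mass_balance:
  assumes "e \<in> V" "g \<in> V" "e \<noteq> g"
  shows "j \<in> V - {e, g} \<Longrightarrow> (\<Sum>k\<in>V - {g}. excursion_mass e g k * Q k j) = 0"
    and "excursion_mass e g e * Q e e = - 1"
proof -
  interpret prob_space "M e" using prob_spaces[OF assms(1)] .
  obtain T c where T: "0 < T" and c: "0 < c" "c \<le> 1" "\<And>k. k \<in> V \<Longrightarrow> c \<le> transition k g T"
    using uniform_positive_transition[OF assms(2)] by blast
  define h where "h m = T / real (Suc m)" for m
  define F where "F m k n = prob (alive_event e g (h m) k n)" for m k n
  define G where "G m k = h m * (\<Sum>n. F m k (Suc n))" for m k
  \<comment> \<open>\<open>F\<close>: probability of each sample, \<open>G\<close>: area of the sampled region, \<open>R\<close>: one-step matrix of the recursion.\<close>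
  define R where "R m k j = (if j = e \<and> k \<noteq> e then 0 else transition k j (h m))" for m k j
  have h: "0 < h m" for m using T by (simp add: h_def)
  have h0: "h \<longlonglongrightarrow> 0" unfolding h_def by (rule subdivision_tendsto_0)
  have summ: "summable (\<lambda>n. F m k (Suc n))" for m k
    unfolding F_def h_def by (rule summable_alive[OF assms T c])
  have lim: "(\<lambda>m. G m k) \<longlonglongrightarrow> excursion_mass e g k" for k
    unfolding G_def F_def h_def by (rule sampled_mass_tendsto[OF assms T c])
  \<comment> \<open>The term \<open>h m * R m e j\<close> stems from the sample at time \<open>0\<close>, which \<open>G\<close> omits.\<close>
  have G_eq: "G m j = (\<Sum>k\<in>V - {g}. G m k * R m k j) + h m * R m e j" if j: "j \<in> V - {g}" for m j
  proof -
    have rec: "F m j (Suc n) = (\<Sum>k\<in>V - {g}. F m k n * R m k j)" for n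
      unfolding F_def R_def using j by (intro alive_recursion assms h) auto
    have sums: "(\<lambda>n. F m k n) sums (of_bool (k = e) + (\<Sum>n. F m k (Suc n)))" for k
      using sums_Suc[OF summable_sums[OF summ[of m k]]] alive_initial[OF assms(1,3), of "h m" k]
      by (simp add: F_def add.commute)
    have "(\<lambda>n. \<Sum>k\<in>V - {g}. F m k n * R m k j) sums
        (\<Sum>k\<in>V - {g}. (of_bool (k = e) + (\<Sum>n. F m k (Suc n))) * R m k j)"
      by (intro sums_sum sums_mult2 sums)
    then have "(\<Sum>n. F m j (Suc n)) = (\<Sum>k\<in>V - {g}. (of_bool (k = e) + (\<Sum>n. F m k (Suc n))) * R m k j)"
      unfolding rec by (rule sums_unique[symmetric])
    then have "G m j = (\<Sum>k\<in>V - {g}. h m * of_bool (k = e) * R m k j + G m k * R m k j)"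
      by (simp add: G_def sum_distrib_left algebra_simps)
    also have "\<dots> = (\<Sum>k\<in>V - {g}. h m * of_bool (k = e) * R m k j) + (\<Sum>k\<in>V - {g}. G m k * R m k j)"
      by (rule sum.distrib)
    also have "(\<Sum>k\<in>V - {g}. h m * of_bool (k = e) * R m k j) = h m * R m e j"
      using assms finite_states by (subst sum.remove[of _ e]) (auto intro!: sum.neutral)
    finally show ?thesis by simp
  qed
  show "(\<Sum>k\<in>V - {g}. excursion_mass e g k * Q k j) = 0" if j: "j \<in> V - {e, g}"
  proof -
    have "(\<lambda>m. \<Sum>k\<in>V - {g}. G m k * ((transition k j (h m) - of_bool (k = j)) / h m))
        \<longlonglongrightarrow> (\<Sum>k\<in>V - {g}. excursion_mass e g k * Q k j)"
      using j by (intro tendsto_sum tendsto_mult lim transition_quotient h h0) auto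
    moreover have "(\<Sum>k\<in>V - {g}. G m k * ((transition k j (h m) - of_bool (k = j)) / h m))
        = - transition e j (h m)" for m
    proof -
      have "(\<Sum>k\<in>V - {g}. G m k * ((transition k j (h m) - of_bool (k = j)) / h m))
          = ((\<Sum>k\<in>V - {g}. G m k * transition k j (h m)) - (\<Sum>k\<in>V - {g}. G m k * of_bool (k = j))) / h m"
        by (simp add: sum_divide_distrib sum_subtractf diff_divide_distrib right_diff_distrib)
      also have "(\<Sum>k\<in>V - {g}. G m k * of_bool (k = j)) = G m j"
        using j finite_states by (subst sum.remove[of _ j]) (auto intro!: sum.neutral)
      also have "(\<Sum>k\<in>V - {g}. G m k * transition k j (h m)) - G m j = - (h m * transition e j (h m))"
        using G_eq[of j m] j by (simp add: R_def)
      finally show ?thesis using h[of m] by simp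
    qed
    ultimately have "(\<lambda>m. - transition e j (h m)) \<longlonglongrightarrow> (\<Sum>k\<in>V - {g}. excursion_mass e g k * Q k j)"
      by simp
    moreover have "(\<lambda>m. - transition e j (h m)) \<longlonglongrightarrow> - of_bool (e = j)"
      using j by (intro tendsto_minus transition_small_time assms h h0) auto
    ultimately show ?thesis using j by (auto dest: LIMSEQ_unique)
  qed
  have "(\<lambda>m. G m e * ((transition e e (h m) - of_bool (e = e)) / h m)) \<longlonglongrightarrow> excursion_mass e g e * Q e e"
    by (intro tendsto_mult lim transition_quotient assms h h0)
  moreover have "G m e * ((transition e e (h m) - of_bool (e = e)) / h m) = - transition e e (h m)" for m
  proof -
    have "(\<Sum>k\<in>V - {g}. G m k * R m k e) = G m e * transition e e (h m)"
      using assms finite_states by (subst sum.remove[of _ e]) (auto simp: R_def intro!: sum.neutral)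
    then have "G m e = G m e * transition e e (h m) + h m * transition e e (h m)"
      using G_eq[of e m] assms by (simp add: R_def)
    then show ?thesis using h[of m] by (simp add: field_simps)
  qed
  ultimately have "(\<lambda>m. - transition e e (h m)) \<longlonglongrightarrow> excursion_mass e g e * Q e e" by simp
  moreover have "(\<lambda>m. - transition e e (h m)) \<longlonglongrightarrow> - of_bool (e = e)"
    by (intro tendsto_minus transition_small_time assms h h0)
  ultimately show "excursion_mass e g e * Q e e = - 1" by (auto dest: LIMSEQ_unique)
qed

end

section \<open>Occupation times during an excursion\<close>

lemma weighted_conditional_expectation:
  fixes q p :: real and I :: ennreal
  assumes "0 \<le> q" "0 \<le> p" "p = 0 \<Longrightarrow> I = 0"
  shows "ennreal (q * p) * (if p \<noteq> 0 then I / ennreal p else 0) = ennreal q * I"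
proof (cases "p = 0")
  case False
  then have "ennreal p * (I / ennreal p) = I"
    using assms(2) by (simp add: ennreal_times_divide mult_divide_eq_ennreal mult.commute[of "ennreal p"])
  then show ?thesis using assms False by (simp add: ennreal_mult mult.assoc)
qed (use assms in simp)

context irreducible_ctmc
begin

text \<open>
Equal times are infinite, and then the path avoids \<open>g\<close> forever, which has probability zero.
\<close>

lemma return_times_differ:
  assumes "e \<in> V" "g \<in> V" "e \<noteq> g"
  shows "AE \<omega> in M e. hitting_time X e \<omega> \<noteq> hitting_time X g \<omega>"
proof -
  interpret prob_space "M e" using prob_spaces[OF assms(1)] .
  obtain T c where T: "0 < T" and c: "0 < c" "c \<le> 1" "\<And>k. k \<in> V \<Longrightarrow> c \<le> transition k g T"
    using uniform_positive_transition[OF assms(2)] by blast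
  define D where "D = (\<Inter>n. avoid_event e g T n)"
  have avoid: "avoid_event e g T n \<in> sets (M e)" for n using avoid_event_measurable assms T by blast
  have D: "D \<in> sets (M e)" unfolding D_def using avoid by blast
  have "prob D \<le> (1 - c) ^ n" for n
  proof -
    have "prob D \<le> prob (avoid_event e g T n)"
      using avoid by (intro finite_measure_mono) (auto simp: D_def)
    also have "\<dots> \<le> (1 - c) ^ n" by (rule avoid_probability_bound[OF assms(1,2) T c(3,2)])
    finally show ?thesis .
  qed
  moreover have "(\<lambda>n. (1 - c) ^ n) \<longlonglongrightarrow> 0" using c by (intro LIMSEQ_realpow_zero) auto
  ultimately have "prob D \<le> 0" by (intro LIMSEQ_le_const) auto
  then have "prob D = 0" by (simp add: measure_le_0_iff)
  then have "AE \<omega> in M e. \<omega> \<notin> D"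
    using D by (intro AE_not_in) (simp add: null_sets_def emeasure_eq_measure)
  moreover have "AE \<omega> in M e. \<omega> \<in> space (M e)" by (rule AE_space)
  ultimately show ?thesis using start[OF assms(1)]
  proof eventually_elim
    case (elim \<omega>)
    interpret right_continuous_path X \<omega> using right_continuous_sample_path[OF assms(1) elim(2)] .
    show ?case
    proof
      assume "hitting_time X e \<omega> = hitting_time X g \<omega>"
      then have never: "hitting_time X g \<omega> = \<infinity>"
        using hitting_times_differ[OF elim(3) assms(3)] by blast
      have "X (T * real b) \<omega> \<noteq> g" for b
      proof (cases "b = 0")
        case False
        have "0 \<le> T * real b" "X 0 \<omega> \<noteq> g" using T elim(3) assms(3) by auto
        then show ?thesis
          using hitting_le_iff[of g "T * real b"] never T False by fastforce
      qed (use elim(3) assms(3) in simp)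
      then show False using elim(1,2) by (simp add: D_def avoid_event_def)
    qed
  qed
qed

text \<open>
The definition multiplies conditional expectations by the probabilities of their conditions, so
these probabilities cancel. Up to the earlier one of the two hitting times the path is in its
excursion, and one of the two is almost surely earlier than the other.
\<close>

lemma excursion_occupation_eq_mass:
  assumes "1 \<in> V" "2 \<in> V" "e \<in> {1, 2}" "k \<in> V"
  shows "excursion_occupation M X Q e k = ennreal (- Q e e * excursion_mass e (3 - e) k)"
proof -
  define g where "g = 3 - e"
  have eg: "e \<in> V" "g \<in> V" "e \<noteq> g" "3 - g = e" using assms by (auto simp: g_def)
  interpret prob_space "M e" using prob_spaces[OF eg(1)] .
  obtain T c where T: "0 < T" and c: "0 < c" "c \<le> 1" "\<And>k. k \<in> V \<Longrightarrow> c \<le> transition k g T"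
    using uniform_positive_transition[OF eg(2)] by blast
  let ?B = "excursion_region e g k"
  have B: "?B \<in> sets (M e \<Otimes>\<^sub>M lborel)" by (rule excursion_region_measurable[OF eg(1-3) T c])
  have B_finite: "emeasure (M e \<Otimes>\<^sub>M lborel) ?B < \<infinity>"
    by (rule excursion_region_finite[OF eg(1-3) T c])
  \<comment> \<open>Length of the section of the region at \<open>\<omega>\<close>.\<close>
  define sec where "sec \<omega> = emeasure lborel (Pair \<omega> -` ?B)" for \<omega>
  have sec_meas [measurable]: "sec \<in> borel_measurable (M e)"
    unfolding sec_def using B by (rule lborel.measurable_emeasure_Pair)
  have sec_integral: "(\<integral>\<^sup>+\<omega>. sec \<omega> \<partial>M e) = ennreal (excursion_mass e g k)"
    unfolding sec_def excursion_mass_def lborel.emeasure_pair_measure_alt[OF B, symmetric]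
    using B_finite by (intro emeasure_eq_ennreal_measure) auto
  define before where "before a = {\<omega>\<in>space (M e). hitting_time X a \<omega> < hitting_time X (3 - a) \<omega>}" for a
  have before [measurable]: "before a \<in> sets (M e)" for a
    unfolding before_def using hitting_time_measurable[OF eg(1)] by (intro borel_measurable_less)
  have integral_eq: "(\<integral>\<^sup>+\<omega>. occupation_time X a k \<omega> *
        indicator {\<omega>. hitting_time X a \<omega> < hitting_time X (3 - a) \<omega>} \<omega> \<partial>M e) =
      (\<integral>\<^sup>+\<omega>. sec \<omega> * indicator (before a) \<omega> \<partial>M e)" if a: "a \<in> {e, g}" for a
  proof (rule nn_integral_cong_AE)
    have "AE \<omega> in M e. \<omega> \<in> space (M e)" by (rule AE_space)
    then show "AE \<omega> in M e. occupation_time X a k \<omega> *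
        indicator {\<omega>. hitting_time X a \<omega> < hitting_time X (3 - a) \<omega>} \<omega> = sec \<omega> * indicator (before a) \<omega>"
      using start[OF eg(1)]
    proof eventually_elim
      case (elim \<omega>)
      show ?case
      proof (cases "hitting_time X a \<omega> < hitting_time X (3 - a) \<omega>")
        case True
        have "{a, 3 - a} = {e, g}" using a eg(4) g_def by auto
        then have "Pair \<omega> -` ?B = {t. 0 \<le> t \<and> ereal t < hitting_time X a \<omega> \<and> X t \<omega> = k}"
          using elim True unfolding excursion_region_def by (auto simp: doubleton_eq_iff dest: less_trans)
        moreover have "Pair \<omega> -` ?B \<in> sets lborel" using B by (rule sets_Pair1)
        ultimately have "occupation_time X a k \<omega> = sec \<omega>"
          unfolding occupation_time_def sec_def by (simp add: nn_integral_indicator)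
        then show ?thesis using True elim by (simp add: before_def indicator_def)
      qed (simp add: before_def indicator_def)
    qed
  qed
  have "0 \<le> - Q e e"
  proof -
    have "0 \<le> (\<Sum>j\<in>V - {e}. Q e j)"
      using rate_matrix eg(1) by (intro sum_nonneg) (auto simp: rate_matrix_def)
    then show ?thesis using rate_matrix eg(1) by (simp add: rate_matrix_def)
  qed
  have summand: "ennreal (excursion_intensity M X Q e a) * expected_occupation M X e a k =
      ennreal (- Q e e) * (\<integral>\<^sup>+\<omega>. sec \<omega> * indicator (before a) \<omega> \<partial>M e)" if a: "a \<in> {e, g}" for a
  proof -
    have p: "excursion_prob M X e a = prob (before a)" by (simp add: excursion_prob_def before_def)
    have "(\<integral>\<^sup>+\<omega>. sec \<omega> * indicator (before a) \<omega> \<partial>M e) = 0" if "prob (before a) = 0"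
    proof -
      have "AE \<omega> in M e. \<omega> \<notin> before a"
        using that before by (intro AE_not_in) (simp add: null_sets_def emeasure_eq_measure)
      then have "AE \<omega> in M e. sec \<omega> * indicator (before a) \<omega> = 0"
        by eventually_elim simp
      then show ?thesis by (subst nn_integral_0_iff_AE) auto
    qed
    then show ?thesis
      unfolding excursion_intensity_def expected_occupation_def integral_eq[OF a] p
      using \<open>0 \<le> - Q e e\<close> by (intro weighted_conditional_expectation) auto
  qed
  have "excursion_occupation M X Q e k =
      ennreal (- Q e e) * (\<integral>\<^sup>+\<omega>. sec \<omega> * indicator (before e) \<omega> \<partial>M e) +
      ennreal (- Q e e) * (\<integral>\<^sup>+\<omega>. sec \<omega> * indicator (before g) \<omega> \<partial>M e)"
    unfolding excursion_occupation_def g_def[symmetric] using summand by simp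
  also have "\<dots> = ennreal (- Q e e) *
      (\<integral>\<^sup>+\<omega>. sec \<omega> * indicator (before e) \<omega> + sec \<omega> * indicator (before g) \<omega> \<partial>M e)"
    by (subst nn_integral_add) (auto simp: distrib_left)
  also have "(\<integral>\<^sup>+\<omega>. sec \<omega> * indicator (before e) \<omega> + sec \<omega> * indicator (before g) \<omega> \<partial>M e) =
      (\<integral>\<^sup>+\<omega>. sec \<omega> \<partial>M e)"
  proof (rule nn_integral_cong_AE)
    have "AE \<omega> in M e. \<omega> \<in> space (M e)" by (rule AE_space)
    then show "AE \<omega> in M e. sec \<omega> * indicator (before e) \<omega> + sec \<omega> * indicator (before g) \<omega> = sec \<omega>"
      using return_times_differ[OF eg(1-3)]
      by eventually_elim (use eg(4) in \<open>auto simp: before_def g_def[symmetric] indicator_def\<close>)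
  qed
  finally show ?thesis
    using \<open>0 \<le> - Q e e\<close> unfolding sec_integral g_def by (subst ennreal_mult) (auto simp: excursion_mass_def)
qed

text \<open>
The balance equation for the areas, scaled with the rate \<open>- Q e e\<close>; the source term becomes \<open>Q e j\<close>
because the mean holding time in \<open>e\<close> is \<open>- 1 / Q e e\<close>.
\<close>

lemma excursion_system:
  assumes "1 \<in> V" "2 \<in> V"
  shows "excursion_system V Q (\<lambda>e k. - Q e e * excursion_mass e (3 - e) k)"
proof
  fix e :: int assume e: "e \<in> {1, 2}"
  have eg: "e \<in> V" "3 - e \<in> V" "e \<noteq> 3 - e" "V - {1, 2} = V - {e, 3 - e}" using e assms by auto
  have mass: "excursion_mass e (3 - e) e * Q e e = - 1" by (rule excursion_mass_balance(2)[OF eg(1-3)])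
  have nonneg: "0 \<le> excursion_mass a b c" for a b c by (simp add: excursion_mass_def)
  show "0 \<le> - Q e e * excursion_mass e (3 - e) i" for i
  proof -
    have "0 \<le> - Q e e"
      using mass nonneg[of e "3 - e" e] by (metis mult_nonneg_nonneg neg_0_le_iff_le not_one_le_zero linear)
    then show ?thesis using nonneg by (intro mult_nonneg_nonneg)
  qed
  fix j assume j: "j \<in> V - {1, 2}"
  have "(\<Sum>k\<in>V - {3 - e}. excursion_mass e (3 - e) k * Q k j) = 0"
    using j eg by (intro excursion_mass_balance(1)) auto
  moreover have "V - {3 - e} - {e} = V - {1, 2}" using eg by auto
  ultimately have "excursion_mass e (3 - e) e * Q e j +
      (\<Sum>k\<in>V - {1, 2}. excursion_mass e (3 - e) k * Q k j) = 0"
    using sum.remove[of "V - {3 - e}" e "\<lambda>k. excursion_mass e (3 - e) k * Q k j"] eg finite_states by auto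
  then have "- Q e e * (excursion_mass e (3 - e) e * Q e j +
      (\<Sum>k\<in>V - {1, 2}. excursion_mass e (3 - e) k * Q k j)) = 0" by simp
  moreover have "- Q e e * (excursion_mass e (3 - e) e * Q e j) = Q e j"
    using mass by (simp add: mult.assoc[symmetric] mult.commute[of "Q e e"])
  ultimately show "Q e j + (\<Sum>i\<in>V - {1, 2}. - Q e e * excursion_mass e (3 - e) i * Q i j) = 0"
    by (simp only: distrib_left sum_distrib_left mult.assoc)
qed (use assms finite_states rate_matrix rates_irreducible in auto)

end

section \<open>Gluing two chains\<close>

lemma glued_sum:
  assumes "2 \<le> r" "2 \<le> s"
  shows "(\<Sum>i\<in>{- int r + 3..int s}. f i * glued_rates QA QB i j) =
    of_bool (j \<le> 2) * (\<Sum>i\<in>states_A r. f i * QA i j) + of_bool (1 \<le> j) * (\<Sum>i\<in>states_B s. f i * QB i j)"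
proof -
  have "(\<Sum>i\<in>{- int r + 3..int s}. f i * glued_rates QA QB i j) =
      of_bool (j \<le> 2) * (\<Sum>i\<in>{- int r + 3..int s}. if i \<le> 2 then f i * QA i j else 0) +
      of_bool (1 \<le> j) * (\<Sum>i\<in>{- int r + 3..int s}. if 1 \<le> i then f i * QB i j else 0)"
    unfolding sum_distrib_left sum.distrib[symmetric]
    by (intro sum.cong) (auto simp: glued_rates_def algebra_simps)
  moreover have "states_A r = {i\<in>{- int r + 3..int s}. i \<le> 2}" "states_B s = {i\<in>{- int r + 3..int s}. 1 \<le> i}"
    using assms by (auto simp: states_A_def states_B_def)
  then have "(\<Sum>i\<in>states_A r. f i * QA i j) = (\<Sum>i\<in>{- int r + 3..int s}. if i \<le> 2 then f i * QA i j else 0)"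
    "(\<Sum>i\<in>states_B s. f i * QB i j) = (\<Sum>i\<in>{- int r + 3..int s}. if 1 \<le> i then f i * QB i j else 0)"
    by (simp_all only: sum.inter_filter finite_atLeastAtMost_int)
  ultimately show ?thesis by (simp only:)
qed

text \<open>
A closed set of the glued chain meets each component in a closed set of that component, that is,
in nothing or in everything, and the components share the ports.
\<close>

lemma glued_irreducible:
  assumes "2 \<le> r" "2 \<le> s"
    and A: "rate_matrix (states_A r) QA" "rates_irreducible (states_A r) QA"
    and B: "rate_matrix (states_B s) QB" "rates_irreducible (states_B s) QB"
  shows glued_nonneg: "\<And>i j. i \<in> {- int r + 3..int s} \<Longrightarrow> j \<in> {- int r + 3..int s} \<Longrightarrow> i \<noteq> j \<Longrightarrow> 0 \<le> glued_rates QA QB i j"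
    and "rates_irreducible {- int r + 3..int s} (glued_rates QA QB)"
proof -
  let ?W = "{- int r + 3..int s}"
  have nonneg: "i \<noteq> j \<Longrightarrow> i \<in> states_A r \<Longrightarrow> j \<in> states_A r \<Longrightarrow> 0 \<le> QA i j"
    "i \<noteq> j \<Longrightarrow> i \<in> states_B s \<Longrightarrow> j \<in> states_B s \<Longrightarrow> 0 \<le> QB i j" for i j
    using A(1) B(1) by (auto simp: rate_matrix_def)
  have W: "?W = states_A r \<union> states_B s" "1 \<in> states_A r \<inter> states_B s" "2 \<in> states_A r \<inter> states_B s"
    using assms(1,2) by (auto simp: states_A_def states_B_def)
  have part: "0 \<le> QA i j * of_bool (i \<le> 2 \<and> j \<le> 2)" "0 \<le> QB i j * of_bool (1 \<le> i \<and> 1 \<le> j)"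
    if "i \<in> ?W" "j \<in> ?W" "i \<noteq> j" for i j
    using that nonneg[of i j] by (auto simp: states_A_def states_B_def)
  show "0 \<le> glued_rates QA QB i j" if "i \<in> ?W" "j \<in> ?W" "i \<noteq> j" for i j
    unfolding glued_rates_def using part[OF that] by (rule add_nonneg_nonneg)
  show "rates_irreducible ?W (glued_rates QA QB)"
    unfolding rates_irreducible_def
  proof (intro allI impI)
    fix C assume C: "C \<subseteq> ?W" "C \<noteq> {}" "\<forall>i\<in>C. \<forall>j\<in>?W - C. glued_rates QA QB i j = 0"
    have parts: "QA i j * of_bool (i \<le> 2 \<and> j \<le> 2) = 0" "QB i j * of_bool (1 \<le> i \<and> 1 \<le> j) = 0"
      if "i \<in> C" "j \<in> ?W - C" for i j
    proof -
      have ij: "i \<in> ?W" "j \<in> ?W" "i \<noteq> j" and "glued_rates QA QB i j = 0" using that C by blast+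
      then show "QA i j * of_bool (i \<le> 2 \<and> j \<le> 2) = 0" "QB i j * of_bool (1 \<le> i \<and> 1 \<le> j) = 0"
        using part[OF ij] unfolding glued_rates_def by linarith+
    qed
    have "C \<inter> states_A r = {} \<or> C \<inter> states_A r = states_A r"
    proof -
      have "\<forall>i\<in>C \<inter> states_A r. \<forall>j\<in>states_A r - C \<inter> states_A r. QA i j = 0"
        using parts(1) W(1) by (force simp: states_A_def)
      then show ?thesis using A(2) unfolding rates_irreducible_def by (meson Int_lower2)
    qed
    moreover have "C \<inter> states_B s = {} \<or> C \<inter> states_B s = states_B s"
    proof -
      have "\<forall>i\<in>C \<inter> states_B s. \<forall>j\<in>states_B s - C \<inter> states_B s. QB i j = 0"
        using parts(2) W(1) by (force simp: states_B_def)
      then show ?thesis using B(2) unfolding rates_irreducible_def by (meson Int_lower2)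
    qed
    ultimately show "C = ?W" using C(1,2) W by blast
  qed
qed

text \<open>
With weights of the same sign, the two differences can only cancel if they have opposite signs;
they do not both vanish as \<open>a \<noteq> b\<close>.
\<close>

lemma strictly_between:
  fixes x a b :: real
  assumes "0 < \<alpha>" "0 < \<beta>" "\<alpha> * (x - a) + \<beta> * (x - b) = 0" "a \<noteq> b"
  shows "min a b < x" "x < max a b" "x \<noteq> a" "x \<noteq> b"
proof -
  have "(a < x \<and> x < b) \<or> (b < x \<and> x < a)"
  proof (rule ccontr)
    assume "\<not> ?thesis"
    then have "(a \<le> x \<and> b \<le> x) \<or> (x \<le> a \<and> x \<le> b)" using assms(4) by linarith
    then have "\<alpha> * (x - a) = 0 \<and> \<beta> * (x - b) = 0"
    proof
      assume "a \<le> x \<and> b \<le> x"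
      then have "0 \<le> \<alpha> * (x - a)" "0 \<le> \<beta> * (x - b)" using assms(1,2) by auto
      then show ?thesis using assms(3) by linarith
    next
      assume "x \<le> a \<and> x \<le> b"
      then have "\<alpha> * (x - a) \<le> 0" "\<beta> * (x - b) \<le> 0" using assms(1,2) by (auto simp: mult_le_0_iff)
      then show ?thesis using assms(3) by linarith
    qed
    then show False using assms by simp
  qed
  then show "min a b < x" "x < max a b" "x \<noteq> a" "x \<noteq> b" by auto
qed

theorem theorem7:
  fixes r s :: nat
    and MA :: "int \<Rightarrow> 'a measure" and XA :: "real \<Rightarrow> 'a \<Rightarrow> int"
    and MB :: "int \<Rightarrow> 'b measure" and XB :: "real \<Rightarrow> 'b \<Rightarrow> int"
    and QA QB :: "int \<Rightarrow> int \<Rightarrow> real"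
    and piA piB p :: "int \<Rightarrow> real"
  assumes "2 \<le> r" and "2 \<le> s"
    and "irreducible_ctmc (states_A r) MA XA QA"
    and "irreducible_ctmc (states_B s) MB XB QB"
    and "stationary_distribution (states_A r) QA piA"
    and "stationary_distribution (states_B s) QB piB"
    and "stationary_distribution {- int r + 3..int s} (glued_rates QA QB) p"
    and "piA 1 / piA 2 \<noteq> piB 1 / piB 2"
  shows "(\<forall>i\<in>states_A r - {1, 2}.
           enn2ereal (excursion_occupation MA XA QA 1 i) =
             ereal ((piA 2 * p i - p 2 * piA i) / (piA 2 * p 1 - p 2 * piA 1)) \<and>
           enn2ereal (excursion_occupation MA XA QA 2 i) =
             ereal ((piA 1 * p i - p 1 * piA i) / (piA 1 * p 2 - p 1 * piA 2)))
       \<and> (\<forall>j\<in>states_B s - {1, 2}.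
           enn2ereal (excursion_occupation MB XB QB 1 j) =
             ereal ((piB 2 * p j - p 2 * piB j) / (piB 2 * p 1 - p 2 * piB 1)) \<and>
           enn2ereal (excursion_occupation MB XB QB 2 j) =
             ereal ((piB 1 * p j - p 1 * piB j) / (piB 1 * p 2 - p 1 * piB 2)))
       \<and> (\<forall>i\<in>states_A r - {1, 2}.
           min (p 1 / piA 1) (p 2 / piA 2) \<le> p i / piA i \<and>
           p i / piA i \<le> max (p 1 / piA 1) (p 2 / piA 2))
       \<and> (\<forall>j\<in>states_B s - {1, 2}.
           min (p 1 / piB 1) (p 2 / piB 2) \<le> p j / piB j \<and>
           p j / piB j \<le> max (p 1 / piB 1) (p 2 / piB 2))
       \<and> min (piA 1 / piA 2) (piB 1 / piB 2) < p 1 / p 2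
       \<and> p 1 / p 2 < max (piA 1 / piA 2) (piB 1 / piB 2)"
proof -
  let ?W = "{- int r + 3..int s}"
  interpret CA: irreducible_ctmc "states_A r" MA XA QA by fact
  interpret CB: irreducible_ctmc "states_B s" MB XB QB by fact
  have ports: "1 \<in> states_A r" "2 \<in> states_A r" "1 \<in> states_B s" "2 \<in> states_B s" "1 \<in> ?W" "2 \<in> ?W"
    using assms(1,2) by (auto simp: states_A_def states_B_def)
  define uA where "uA e k = - QA e e * CA.excursion_mass e (3 - e) k" for e k
  define uB where "uB e k = - QB e e * CB.excursion_mass e (3 - e) k" for e k
  interpret A: excursion_system "states_A r" QA uA
    unfolding uA_def by (rule CA.excursion_system[OF ports(1,2)])
  interpret B: excursion_system "states_B s" QB uB
    unfolding uB_def by (rule CB.excursion_system[OF ports(3,4)])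
  have occupation: "enn2ereal (excursion_occupation MA XA QA e i) = ereal (uA e i)"
    if "e \<in> {1, 2}" "i \<in> states_A r - {1, 2}" for e i
    using CA.excursion_occupation_eq_mass[OF ports(1,2) that(1), of i] A.occupation_nonneg[OF that] that(2)
    by (simp add: uA_def)
  have occupation': "enn2ereal (excursion_occupation MB XB QB e i) = ereal (uB e i)"
    if "e \<in> {1, 2}" "i \<in> states_B s - {1, 2}" for e i
    using CB.excursion_occupation_eq_mass[OF ports(3,4) that(1), of i] B.occupation_nonneg[OF that] that(2)
    by (simp add: uB_def)
  have column: "of_bool (j \<le> 2) * (\<Sum>i\<in>states_A r. p i * QA i j) +
      of_bool (1 \<le> j) * (\<Sum>i\<in>states_B s. p i * QB i j) = 0" if "j \<in> ?W" for j
    using assms(7) that glued_sum[OF assms(1,2), of p QA QB j] by (simp add: stationary_distribution_def)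
  have balance_A: "(\<Sum>i\<in>states_A r. p i * QA i j) = 0" if "j \<in> states_A r - {1, 2}" for j
    using column[of j] that assms(2) by (auto simp: states_A_def)
  have balance_B: "(\<Sum>i\<in>states_B s. p i * QB i j) = 0" if "j \<in> states_B s - {1, 2}" for j
    using column[of j] that assms(1) by (auto simp: states_B_def)
  have p_pos: "0 < p i" if "i \<in> ?W" for i
    using stationary_positive[OF _ glued_irreducible[OF assms(1,2) A.rates A.irred B.rates B.irred] assms(7) that]
    by simp
  have A_pos: "0 < piA i" if "i \<in> states_A r" for i
    using stationary_positive[OF A.finite_V _ A.irred assms(5) that] A.rates by (auto simp: rate_matrix_def)
  have B_pos: "0 < piB i" if "i \<in> states_B s" for i
    using stationary_positive[OF B.finite_V _ B.irred assms(6) that] B.rates by (auto simp: rate_matrix_def)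
  note pos = p_pos[OF ports(5)] p_pos[OF ports(6)] A_pos[OF ports(1)] A_pos[OF ports(2)]
    B_pos[OF ports(3)] B_pos[OF ports(4)]
  \<comment> \<open>The positive factors in \<open>net_flow_ratio\<close> for the two components.\<close>
  define \<alpha> where "\<alpha> = A.passage_rate * piA 2 * p 2 / piA 1"
  define \<beta> where "\<beta> = B.passage_rate * piB 2 * p 2 / piB 1"
  have "0 < \<alpha>" "0 < \<beta>" using pos A.passage_rate_pos B.passage_rate_pos by (auto simp: \<alpha>_def \<beta>_def)
  have flow_A: "(\<Sum>i\<in>states_A r. p i * QA i 1) = - (\<alpha> * (p 1 / p 2 - piA 1 / piA 2))"
    unfolding \<alpha>_def using pos by (intro A.net_flow_ratio assms(5) balance_A) auto
  have flow_B: "(\<Sum>i\<in>states_B s. p i * QB i 1) = - (\<beta> * (p 1 / p 2 - piB 1 / piB 2))"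
    unfolding \<beta>_def using pos by (intro B.net_flow_ratio assms(6) balance_B) auto
  have "\<alpha> * (p 1 / p 2 - piA 1 / piA 2) + \<beta> * (p 1 / p 2 - piB 1 / piB 2) = 0"
    using column[OF ports(5)] unfolding flow_A flow_B by simp
  note between = strictly_between[OF \<open>0 < \<alpha>\<close> \<open>0 < \<beta>\<close> this assms(8)]
  have det_A: "piA 2 * p 1 \<noteq> p 2 * piA 1" and det_B: "piB 2 * p 1 \<noteq> p 2 * piB 1"
    using between(3,4) pos by (auto simp: field_simps)
  show ?thesis
    using occupation occupation' between(1,2)
      A.port_quotients[OF assms(5) balance_A det_A] B.port_quotients[OF assms(6) balance_B det_B]
      A.ratio_bounds[OF assms(5) balance_A] B.ratio_bounds[OF assms(6) balance_B]
    by (intro conjI ballI) simp_all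
qed

end
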